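(* Let $1\le p,q\le\infty$ and $\sigma>0$. For each integer $n\ge 1$ put $N=2n+1$, let $\mathbf a=(a_1,\dots,a_N)$ be a Gaussian random vector in $\mathbb R^N$ with mean $0$ and covariance matrix $\sigma^2 I_N$, and let $$T_{\mathbf a}(x)=a_1+\sum_{k=1}^n\big(a_{2k}\sqrt2\cos kx+a_{2k+1}\sqrt2\sin kx\big).$$ Then $$\mathbb E\Big(\frac{\|T_{\mathbf a}\|_q}{\|T_{\mathbf a}\|_p}\Big)\asymp\begin{cases}1,& 1\le p,q<\infty\ \text{ or }\ p=q=\infty,\\ (\ln N)^{1/2},& 1\le p<\infty,\ q=\infty,\\ (\ln N)^{-1/2},& 1\le q<\infty,\ p=\infty,\end{cases}$$ where the constants in $\asymp$ are independent of $n$.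
   Context: $\mathbb T=[0,2\pi]$ is the torus. For $1\le p<\infty$, $\|f\|_p=\big(\frac1{2\pi}\int_{\mathbb T}|f(x)|^p\,dx\big)^{1/p}$, and $\|f\|_\infty=\max_{x\in\mathbb T}|f(x)|$. $I_N$ is the $N\times N$ identity matrix. $A_n\asymp B_n$ means there exist constants $c_1,c_2>0$ independent of $n$ with $c_1B_n\le A_n\le c_2B_n$ for all $n$ under consideration. *)

theory Defs
  imports "HOL-Probability.Probability" "Jordan_Normal_Form.Gauss_Jordan_Elimination"
    "Jordan_Normal_Form.Determinant"
begin

text \<open>The norm in \<open>L\<^sub>p\<close> of the torus \<open>[0, 2\<pi>]\<close> with normalised Lebesgue measure, for
  \<open>1 \<le> p \<le> \<infinity>\<close>. The case \<open>p = \<infinity>\<close> is meant for continuous \<open>f\<close>, where the supremum is a maximum.\<close>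

definition torus_norm :: "ennreal \<Rightarrow> (real \<Rightarrow> real) \<Rightarrow> real" where
  "torus_norm p f =
    (if p = \<infinity> then (SUP x\<in>{0..2 * pi}. \<bar>f x\<bar>)
     else (1 / (2 * pi) * (LBINT x:{0..2 * pi}. \<bar>f x\<bar> powr enn2real p)) powr (1 / enn2real p))"

definition trig_poly :: "nat \<Rightarrow> (nat \<Rightarrow> real) \<Rightarrow> real \<Rightarrow> real" where
  "trig_poly n a x =
    a 1 + (\<Sum>k=1..n. a (2 * k) * sqrt 2 * cos (real k * x)
      + a (2 * k + 1) * sqrt 2 * sin (real k * x))"

definition positive_definite_mat :: "nat \<Rightarrow> real mat \<Rightarrow> bool" where
  "positive_definite_mat N C \<longleftrightarrow>
    C \<in> carrier_mat N N \<and> transpose_mat C = C \<and>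
    (\<forall>v\<in>carrier_vec N. v \<noteq> 0\<^sub>v N \<longrightarrow> 0 < v \<bullet> (C *\<^sub>v v))"

definition gaussian_density :: "real vec \<Rightarrow> real mat \<Rightarrow> real vec \<Rightarrow> real" where
  "gaussian_density m C v =
    exp (- ((v - m) \<bullet> (the (mat_inverse C) *\<^sub>v (v - m))) / 2) / sqrt ((2 * pi) ^ dim_vec m * det C)"

text \<open>\<open>(a\<^sub>1, \<dots>, a\<^sub>N)\<close> is a nondegenerate Gaussian random vector with mean \<open>m\<close> and covariance matrix \<open>C\<close>.
  The coordinates of \<open>a\<close> are numbered from 1, while those of vectors and matrices are numbered from 0.
  The coordinate \<open>a i \<omega>\<close> is irrelevant for \<open>i\<close> outside \<open>{1..N}\<close>.\<close>

definition gaussian_vector ::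
    "'w measure \<Rightarrow> nat \<Rightarrow> real vec \<Rightarrow> real mat \<Rightarrow> (nat \<Rightarrow> 'w \<Rightarrow> real) \<Rightarrow> bool" where
  "gaussian_vector M N m C a \<longleftrightarrow>
    m \<in> carrier_vec N \<and> positive_definite_mat N C \<and>
    distributed M (\<Pi>\<^sub>M i\<in>{1..N}. lborel) (\<lambda>\<omega>. \<lambda>i\<in>{1..N}. a i \<omega>)
      (\<lambda>x. ennreal (gaussian_density m C (vec N (\<lambda>i. x (Suc i)))))"

definition growth_rate :: "ennreal \<Rightarrow> ennreal \<Rightarrow> nat \<Rightarrow> real" where
  "growth_rate p q N =
    (if p < \<infinity> \<and> q < \<infinity> \<or> p = \<infinity> \<and> q = \<infinity> then 1
     else if p < \<infinity> \<and> q = \<infinity> then ln (real N) powr (1 / 2)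
     else ln (real N) powr (- 1 / 2))"

end

theory Submission
  imports Defs
begin

text \<open>Write \<open>N = 2 n + 1\<close> and \<open>\<tau> = \<sigma> \<surd>N\<close>, so that every \<open>T x\<close> is a normal variable with standard
  deviation \<open>\<tau>\<close>, and let \<open>I\<close> be the mean of \<open>exp (T\<^sup>2 / (4 \<tau>\<^sup>2))\<close> over the torus; its expectation is
  \<open>\<surd>2\<close>. Only upper bounds for the expected ratio \<open>R\<close> are needed, because \<open>R \<ge> 2 k - k\<^sup>2 / R\<close> turns an upper
  bound for \<open>1 / R\<close>, the ratio with \<open>p\<close> and \<open>q\<close> exchanged, into a lower bound for \<open>R\<close>.

  Every norm of finite order is at most a constant times \<open>\<tau> \<surd>I\<close>, and since \<open>\<bar>T\<bar>\<close> exceeds half its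
  supremum on an interval of polynomially small length, the supremum is at most a constant times
  \<open>\<tau> \<surd>(I ln N)\<close>. For \<open>p < \<infinity>\<close> the norm of order \<open>p\<close> is bounded below through the norms of order 2 and 4, where
  Parseval's identity identifies the square of the former with \<open>a\<^sub>1\<^sup>2 + \<dots> + a\<^sub>N\<^sup>2\<close>; this exceeds \<open>\<tau>\<^sup>2 / 4\<close> outside
  an event of exponentially small probability, on which the ratio is still at most polynomial in \<open>N\<close>.
  For \<open>p = \<infinity>\<close> a second moment argument at \<open>N\<close> equidistant nodes shows that the supremum is at least
  a constant times \<open>\<tau> \<surd>(ln N)\<close> with high probability.\<close>

section \<open>Gaussian vectors and their linear combinations\<close>

text \<open>For a scalar covariance the inverse and the determinant are explicit, so the joint
  density factors; vector entry \<open>i\<close> carries coordinate \<open>Suc i\<close>.\<close>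

lemma gaussian_density_scaled_id:
  fixes \<sigma> :: real and x :: "nat \<Rightarrow> real"
  assumes "0 < \<sigma>"
  shows "gaussian_density (0\<^sub>v N) (\<sigma>\<^sup>2 \<cdot>\<^sub>m 1\<^sub>m N) (vec N (\<lambda>i. x (Suc i))) =
    (\<Prod>i\<in>{1..N}. normal_density 0 \<sigma> (x i))"
proof -
  let ?C = "\<sigma>\<^sup>2 \<cdot>\<^sub>m 1\<^sub>m N :: real mat"
  let ?D = "(1 / \<sigma>\<^sup>2) \<cdot>\<^sub>m 1\<^sub>m N :: real mat"
  define v where "v = vec N (\<lambda>i. x (Suc i))"
  have v: "v \<in> carrier_vec N" by (simp add: v_def)
  have C: "?C \<in> carrier_mat N N" and D: "?D \<in> carrier_mat N N" by auto
  have DC: "?D * ?C = 1\<^sub>m N" and CD: "?C * ?D = 1\<^sub>m N"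
    using assms by (auto simp: mult_smult_assoc_mat[of _ N N] mult_smult_distrib[of _ N N] intro!: eq_matI)
  \<comment> \<open>\<open>mat_inverse\<close> returns an option. The explicit inverse
    \<open>?D\<close> rules out \<open>None\<close>, and associativity forces any returned right
    inverse to equal \<open>?D\<close>.\<close>
  have inv: "the (mat_inverse ?C) = ?D"
  proof (cases "mat_inverse ?C")
    case None
    then have "?C \<notin> Units (ring_mat TYPE(real) N ())"
      by (rule mat_inverse(1)[OF C])
    moreover have "?C \<in> Units (ring_mat TYPE(real) N ())"
      unfolding Units_def using C D CD DC by (auto simp: ring_mat_def)
    ultimately show ?thesis by blast
  next
    case (Some B)
    then have B: "?C * B = 1\<^sub>m N" "B \<in> carrier_mat N N"
      using mat_inverse(2)[OF C] by auto
    have "?D = ?D * (?C * B)" using B D by simp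
    also have "\<dots> = ?D * ?C * B" using B C D by (simp add: assoc_mult_mat[of _ N N _ N _ N])
    also have "\<dots> = B" using B DC by simp
    finally show ?thesis using Some by simp
  qed
  have sc: "scalar_prod v (?D *\<^sub>v v) = (1 / \<sigma>\<^sup>2) * (\<Sum>i\<in>{1..N}. (x i)\<^sup>2)"
  proof -
    have "?D *\<^sub>v v = (1 / \<sigma>\<^sup>2) \<cdot>\<^sub>v v"
      using v by (intro eq_vecI) auto
    then have "scalar_prod v (?D *\<^sub>v v) = (1 / \<sigma>\<^sup>2) * scalar_prod v v" using v by simp
    also have "scalar_prod v v = (\<Sum>i\<in>{0..<N}. (x (Suc i))\<^sup>2)"
      by (simp add: scalar_prod_def v_def power2_eq_square)
    also have "\<dots> = (\<Sum>i\<in>{1..N}. (x i)\<^sup>2)"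
      by (rule sum.reindex_bij_witness[of _ "\<lambda>i. i - 1" Suc]) auto
    finally show ?thesis .
  qed
  have dt: "det ?C = (\<sigma>\<^sup>2) ^ N" by simp
  have "(\<Prod>i\<in>{1..N}. normal_density 0 \<sigma> (x i)) =
     (\<Prod>i\<in>{1..N}. 1 / sqrt (2 * pi * \<sigma>\<^sup>2)) * (\<Prod>i\<in>{1..N}. exp (- (x i)\<^sup>2 / (2 * \<sigma>\<^sup>2)))"
    by (simp only: normal_density_def prod.distrib diff_zero)
  also have "\<dots> = 1 / sqrt ((2 * pi * \<sigma>\<^sup>2) ^ N) * exp (\<Sum>i\<in>{1..N}. - (x i)\<^sup>2 / (2 * \<sigma>\<^sup>2))"
    by (simp add: exp_sum power_one_over real_sqrt_power)
  also have "(\<Sum>i\<in>{1..N}. - (x i)\<^sup>2 / (2 * \<sigma>\<^sup>2)) = - ((1 / \<sigma>\<^sup>2) * (\<Sum>i\<in>{1..N}. (x i)\<^sup>2)) / 2"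
    by (simp add: sum_negf sum_divide_distrib sum_distrib_left mult.commute)
  finally have pr: "(\<Prod>i\<in>{1..N}. normal_density 0 \<sigma> (x i)) =
     1 / sqrt ((2 * pi * \<sigma>\<^sup>2) ^ N) * exp (- ((1 / \<sigma>\<^sup>2) * (\<Sum>i\<in>{1..N}. (x i)\<^sup>2)) / 2)" .
  have "v - 0\<^sub>v N = v" using v by auto
  then show ?thesis
    unfolding pr gaussian_density_def v_def[symmetric] inv dt
    by (simp add: sc power_mult_distrib)
qed

text \<open>A product measure is determined by its values on rectangles, where the product density
  integrates factor by factor.\<close>

lemma gaussian_vector_distr:
  assumes "prob_space M" and "gaussian_vector M N (0\<^sub>v N) (\<sigma>\<^sup>2 \<cdot>\<^sub>m 1\<^sub>m N) a" and "0 < \<sigma>"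
  shows "distr M (\<Pi>\<^sub>M i\<in>{1..N}. lborel) (\<lambda>\<omega>. \<lambda>i\<in>{1..N}. a i \<omega>) =
    (\<Pi>\<^sub>M i\<in>{1..N}. density lborel (normal_density 0 \<sigma>))"
proof -
  let ?P = "\<Pi>\<^sub>M i\<in>{1..N}. lborel :: real measure"
  let ?f = "\<lambda>x :: nat \<Rightarrow> real. ennreal (\<Prod>i\<in>{1..N}. normal_density 0 \<sigma> (x i))"
  interpret L: product_sigma_finite "\<lambda>_::nat. lborel :: real measure"
    by standard
  interpret G: product_prob_space "\<lambda>_::nat. density lborel (normal_density 0 \<sigma>)"
    by (intro product_prob_spaceI prob_space_normal_density assms(3))
  have mf: "?f \<in> borel_measurable ?P" by measurable
  have "distr M ?P (\<lambda>\<omega>. \<lambda>i\<in>{1..N}. a i \<omega>) = density ?P ?f"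
    using assms(2,3) unfolding gaussian_vector_def distributed_def
    by (simp add: gaussian_density_scaled_id)
  also have "\<dots> = (\<Pi>\<^sub>M i\<in>{1..N}. density lborel (normal_density 0 \<sigma>))"
  proof (rule G.PiM_eqI)
    show "sets (density ?P ?f) = sets (\<Pi>\<^sub>M i\<in>{1..N}. density lborel (normal_density 0 \<sigma>))"
      by (simp cong: sets_PiM_cong)
    fix A :: "nat \<Rightarrow> real set" assume A: "\<And>i. i \<in> {1..N} \<Longrightarrow> A i \<in> sets (density lborel (normal_density 0 \<sigma>))"
    then have mA: "Pi\<^sub>E {1..N} A \<in> sets ?P" by (auto intro!: sets_PiM_I_finite)
    have "emeasure (density ?P ?f) (Pi\<^sub>E {1..N} A) = (\<integral>\<^sup>+x. ?f x * indicator (Pi\<^sub>E {1..N} A) x \<partial>?P)"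
      by (rule emeasure_density[OF mf mA])
    also have "\<dots> = (\<integral>\<^sup>+x. (\<Prod>i\<in>{1..N}. ennreal (normal_density 0 \<sigma> (x i)) * indicator (A i) (x i)) \<partial>?P)"
    proof (rule nn_integral_cong)
      fix x assume x: "x \<in> space ?P"
      then have "indicator (Pi\<^sub>E {1..N} A) x = (\<Prod>i\<in>{1..N}. indicator (A i) (x i) :: ennreal)"
        by (auto simp: indicator_def space_PiM PiE_iff)
      then show "?f x * indicator (Pi\<^sub>E {1..N} A) x = (\<Prod>i\<in>{1..N}. ennreal (normal_density 0 \<sigma> (x i)) * indicator (A i) (x i))"
        by (simp add: prod.distrib prod_ennreal)
    qed
    also have "\<dots> = (\<Prod>i\<in>{1..N}. \<integral>\<^sup>+x. ennreal (normal_density 0 \<sigma> x) * indicator (A i) x \<partial>lborel)"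
      using A by (intro L.product_nn_integral_prod) auto
    also have "\<dots> = (\<Prod>i\<in>{1..N}. emeasure (density lborel (normal_density 0 \<sigma>)) (A i))"
      using A by (intro prod.cong) (auto simp: emeasure_density)
    finally show "emeasure (density ?P ?f) (Pi\<^sub>E {1..N} A) = (\<Prod>i\<in>{1..N}. emeasure (density lborel (normal_density 0 \<sigma>)) (A i))" .
  qed simp
  finally show ?thesis .
qed

text \<open>Both facts are read off the product form of the joint law. Positivity of
  \<open>N\<close> keeps the index set of the independence criterion nonempty.\<close>

lemma
  assumes M: "prob_space M" and g: "gaussian_vector M N (0\<^sub>v N) (\<sigma>\<^sup>2 \<cdot>\<^sub>m 1\<^sub>m N) a" and s: "0 < \<sigma>"
  shows gaussian_vector_coordinate:
      "\<And>i. i \<in> {1..N} \<Longrightarrow> distributed M lborel (a i) (normal_density 0 \<sigma>)"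
    and gaussian_vector_indep: "0 < N \<Longrightarrow> prob_space.indep_vars M (\<lambda>_. borel) a {1..N}"
proof -
  interpret prob_space M by fact
  let ?X = "\<lambda>\<omega>. \<lambda>i\<in>{1..N}. a i \<omega>"
  let ?P = "\<Pi>\<^sub>M i\<in>{1..N}. lborel :: real measure"
  have X[measurable]: "?X \<in> measurable M ?P"
    using g by (simp add: gaussian_vector_def distributed_def)
  have a: "a i \<in> borel_measurable M" if "i \<in> {1..N}" for i
  proof -
    have "(\<lambda>\<omega>. ?X \<omega> i) \<in> measurable M lborel"
      using that by measurable
    then show ?thesis using that by simp
  qed
  have d: "distr M lborel (a i) = density lborel (normal_density 0 \<sigma>)" if i: "i \<in> {1..N}" for i
  proof -
    have "distr M lborel (a i) = distr (distr M ?P ?X) lborel (\<lambda>x. x i)"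
      using i by (subst distr_distr[OF _ X]) (auto simp: comp_def)
    also have "\<dots> = distr (\<Pi>\<^sub>M i\<in>{1..N}. density lborel (normal_density 0 \<sigma>)) (density lborel (normal_density 0 \<sigma>)) (\<lambda>x. x i)"
      unfolding gaussian_vector_distr[OF M g s] by (rule distr_cong) auto
    also have "\<dots> = density lborel (normal_density 0 \<sigma>)"
      using i prob_space_normal_density[OF s] by (intro distr_PiM_component) auto
    finally show ?thesis .
  qed
  show "distributed M lborel (a i) (normal_density 0 \<sigma>)" if "i \<in> {1..N}" for i
    using d a that by (auto simp: distributed_def)
  assume "0 < N"
  then have "indep_vars (\<lambda>_. lborel) a {1..N} \<longleftrightarrow>
    distr M ?P ?X = (\<Pi>\<^sub>M i\<in>{1..N}. distr M lborel (a i))"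
    using a by (intro indep_vars_iff_distr_eq_PiM') auto
  moreover have "distr M ?P ?X = (\<Pi>\<^sub>M i\<in>{1..N}. distr M lborel (a i))"
    unfolding gaussian_vector_distr[OF M g s] using d by (intro PiM_cong) auto
  ultimately show "indep_vars (\<lambda>_. borel) a {1..N}"
    by (simp add: indep_vars_def2)
qed

lemma (in prob_space) linear_combination_normal:
  assumes I: "finite I" and indep: "indep_vars (\<lambda>_. borel) a I" and s: "0 < \<sigma>"
    and d: "\<And>i. i \<in> I \<Longrightarrow> distributed M lborel (a i) (normal_density 0 \<sigma>)"
    and b: "0 < (\<Sum>i\<in>I. (b i)\<^sup>2)"
  shows "distributed M lborel (\<lambda>\<omega>. \<Sum>i\<in>I. b i * a i \<omega>) (normal_density 0 (\<sigma> * sqrt (\<Sum>i\<in>I. (b i)\<^sup>2)))"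
proof -
  \<comment> \<open>Zero coefficients are dropped: their terms are constants and have no normal
    density.\<close>
  let ?J = "{i \<in> I. b i \<noteq> 0}"
  have fJ: "finite ?J" using I by simp
  have b': "(\<Sum>i\<in>?J. (b i)\<^sup>2) = (\<Sum>i\<in>I. (b i)\<^sup>2)"
    using I by (intro sum.mono_neutral_left) auto
  have ne: "?J \<noteq> {}" using b b' by (metis sum.empty less_irrefl)
  have "distributed M lborel (\<lambda>\<omega>. \<Sum>i\<in>?J. b i * a i \<omega>)
     (normal_density (\<Sum>i\<in>?J. 0) (sqrt (\<Sum>i\<in>?J. (\<bar>b i\<bar> * \<sigma>)\<^sup>2)))"
  proof (rule sum_indep_normal[OF fJ ne])
    show "indep_vars (\<lambda>i. borel) (\<lambda>i \<omega>. b i * a i \<omega>) ?J"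
      using indep_vars_compose2[OF indep_vars_subset[OF indep, of ?J], of "\<lambda>i x. b i * x" "\<lambda>_. borel"] by auto
    show "distributed M lborel (\<lambda>\<omega>. b i * a i \<omega>) (normal_density 0 (\<bar>b i\<bar> * \<sigma>))" if "i \<in> ?J" for i
      using normal_density_affine[OF d s, of i "b i" 0] that by simp
  qed (use s in auto)
  also have "(\<Sum>i\<in>?J. (\<bar>b i\<bar> * \<sigma>)\<^sup>2) = \<sigma>\<^sup>2 * (\<Sum>i\<in>I. (b i)\<^sup>2)"
    by (simp add: power_mult_distrib sum_distrib_left mult.commute flip: b')
  also have "(\<lambda>\<omega>. \<Sum>i\<in>?J. b i * a i \<omega>) = (\<lambda>\<omega>. \<Sum>i\<in>I. b i * a i \<omega>)"
    using I by (intro ext sum.mono_neutral_left) auto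
  finally show ?thesis using s by (simp add: real_sqrt_mult)
qed

section \<open>Exponential moments of normal variables\<close>

lemma nn_integral_normal_density:
  assumes "0 < \<sigma>"
  shows "(\<integral>\<^sup>+x. ennreal (normal_density \<mu> \<sigma> x) \<partial>lborel) = 1"
  using prob_space.emeasure_space_1[OF prob_space_normal_density[OF assms], of \<mu>]
  by (simp add: emeasure_density)

text \<open>Completing the square turns the exponential weight into a shift of the mean by
  \<open>r * \<tau>\<^sup>2\<close>. A finite nonnegative integral also supplies
  integrability.\<close>

lemma (in prob_space) normal_exp_moment:
  assumes d: "distributed M lborel X (normal_density 0 \<tau>)" and t: "0 < \<tau>"
  shows "(\<integral>\<^sup>+\<omega>. ennreal (exp (r * X \<omega>)) \<partial>M) = ennreal (exp (r\<^sup>2 * \<tau>\<^sup>2 / 2))"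
proof -
  have "(\<integral>\<^sup>+\<omega>. ennreal (exp (r * X \<omega>)) \<partial>M) = (\<integral>\<^sup>+x. ennreal (normal_density 0 \<tau> x) * ennreal (exp (r * x)) \<partial>lborel)"
    by (rule distributed_nn_integral[OF d, symmetric]) measurable
  also have "\<dots> = (\<integral>\<^sup>+x. ennreal (exp (r\<^sup>2 * \<tau>\<^sup>2 / 2)) * ennreal (normal_density (r * \<tau>\<^sup>2) \<tau> x) \<partial>lborel)"
  proof (rule nn_integral_cong)
    fix x :: real
    have nz: "2 * \<tau>\<^sup>2 \<noteq> 0" using t by simp
    have "- x\<^sup>2 + r * x * (2 * \<tau>\<^sup>2) = r\<^sup>2 * \<tau>\<^sup>2 / 2 * (2 * \<tau>\<^sup>2) - (x - r * \<tau>\<^sup>2)\<^sup>2"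
      by (simp add: power2_eq_square algebra_simps)
    then have "(- x\<^sup>2 + r * x * (2 * \<tau>\<^sup>2)) / (2 * \<tau>\<^sup>2) =
        (r\<^sup>2 * \<tau>\<^sup>2 / 2 * (2 * \<tau>\<^sup>2) - (x - r * \<tau>\<^sup>2)\<^sup>2) / (2 * \<tau>\<^sup>2)"
      by simp
    then have "- x\<^sup>2 / (2 * \<tau>\<^sup>2) + r * x = r\<^sup>2 * \<tau>\<^sup>2 / 2 + - (x - r * \<tau>\<^sup>2)\<^sup>2 / (2 * \<tau>\<^sup>2)"
      using t by (simp only: add_divide_distrib diff_divide_distrib nonzero_mult_div_cancel_right[OF nz])
    then have "exp (- x\<^sup>2 / (2 * \<tau>\<^sup>2)) * exp (r * x) = exp (r\<^sup>2 * \<tau>\<^sup>2 / 2) * exp (- (x - r * \<tau>\<^sup>2)\<^sup>2 / (2 * \<tau>\<^sup>2))"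
      by (simp only: exp_add[symmetric])
    then have "normal_density 0 \<tau> x * exp (r * x) = exp (r\<^sup>2 * \<tau>\<^sup>2 / 2) * normal_density (r * \<tau>\<^sup>2) \<tau> x"
      by (simp add: normal_density_def)
    then show "ennreal (normal_density 0 \<tau> x) * ennreal (exp (r * x)) =
      ennreal (exp (r\<^sup>2 * \<tau>\<^sup>2 / 2)) * ennreal (normal_density (r * \<tau>\<^sup>2) \<tau> x)"
      by (simp add: ennreal_mult[symmetric])
  qed
  also have "\<dots> = ennreal (exp (r\<^sup>2 * \<tau>\<^sup>2 / 2))"
    using t by (simp add: nn_integral_cmult nn_integral_normal_density)
  finally show ?thesis .
qed

text \<open>The weighted density is a multiple of a centred normal density with variance
  \<open>\<tau>\<^sup>2 / (1 - 2 * r)\<close>, hence \<open>r < 1 / 2\<close>. The uses are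
  \<open>r = 1 / 4\<close> for \<open>exp_mean\<close> and \<open>r = - 3 / 2\<close> for a lower
  tail.\<close>

lemma (in prob_space) normal_exp_square_moment:
  assumes d: "distributed M lborel X (normal_density 0 \<tau>)" and t: "0 < \<tau>" and r: "r < 1 / 2"
  shows "(\<integral>\<^sup>+\<omega>. ennreal (exp (r * (X \<omega> / \<tau>)\<^sup>2)) \<partial>M) = ennreal (1 / sqrt (1 - 2 * r))"
proof -
  define w where "w = 1 - 2 * r"
  have w: "0 < w" and r_eq: "r = 1 / 2 - w / 2" using r by (simp_all add: w_def field_simps)
  let ?s = "\<tau> / sqrt w"
  have s: "0 < ?s" using t w by simp
  have "(\<integral>\<^sup>+\<omega>. ennreal (exp (r * (X \<omega> / \<tau>)\<^sup>2)) \<partial>M) = (\<integral>\<^sup>+x. ennreal (normal_density 0 \<tau> x) * ennreal (exp (r * (x / \<tau>)\<^sup>2)) \<partial>lborel)"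
    by (rule distributed_nn_integral[OF d, symmetric]) measurable
  also have "\<dots> = (\<integral>\<^sup>+x. ennreal (1 / sqrt w) * ennreal (normal_density 0 ?s x) \<partial>lborel)"
  proof (rule nn_integral_cong)
    fix x :: real
    have s2: "?s\<^sup>2 = \<tau>\<^sup>2 / w" using w by (simp add: power_divide)
    have "- x\<^sup>2 / (2 * \<tau>\<^sup>2) + r * (x / \<tau>)\<^sup>2 = - (x\<^sup>2 / \<tau>\<^sup>2) / 2 + (1 / 2 - w / 2) * (x\<^sup>2 / \<tau>\<^sup>2)"
      unfolding r_eq by (simp add: power_divide)
    also have "\<dots> = - x\<^sup>2 / (2 * ?s\<^sup>2)"
      unfolding s2 left_diff_distrib by simp
    finally have e: "exp (- x\<^sup>2 / (2 * \<tau>\<^sup>2)) * exp (r * (x / \<tau>)\<^sup>2) = exp (- x\<^sup>2 / (2 * ?s\<^sup>2))"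
      by (simp only: exp_add[symmetric])
    have "sqrt (2 * pi * ?s\<^sup>2) = sqrt (2 * pi * \<tau>\<^sup>2) / sqrt w"
      unfolding s2 by (simp only: times_divide_eq_right real_sqrt_divide)
    then have c: "1 / sqrt (2 * pi * \<tau>\<^sup>2) = 1 / sqrt w * (1 / sqrt (2 * pi * ?s\<^sup>2))"
      using w by simp
    have "normal_density 0 \<tau> x * exp (r * (x / \<tau>)\<^sup>2) =
      1 / sqrt (2 * pi * \<tau>\<^sup>2) * (exp (- x\<^sup>2 / (2 * \<tau>\<^sup>2)) * exp (r * (x / \<tau>)\<^sup>2))"
      by (simp only: normal_density_def diff_zero mult.assoc)
    also have "\<dots> = 1 / sqrt w * normal_density 0 ?s x"
      unfolding e c by (simp only: normal_density_def diff_zero mult.assoc)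
    finally have "normal_density 0 \<tau> x * exp (r * (x / \<tau>)\<^sup>2) = 1 / sqrt w * normal_density 0 ?s x" .
    moreover have "0 \<le> 1 / sqrt w" using w by simp
    ultimately show "ennreal (normal_density 0 \<tau> x) * ennreal (exp (r * (x / \<tau>)\<^sup>2)) =
      ennreal (1 / sqrt w) * ennreal (normal_density 0 ?s x)"
      by (simp only: ennreal_mult[symmetric] normal_density_nonneg exp_ge_zero)
  qed
  also have "\<dots> = ennreal (1 / sqrt w) * (\<integral>\<^sup>+x. ennreal (normal_density 0 ?s x) \<partial>lborel)"
    by (rule nn_integral_cmult) measurable
  finally have "(\<integral>\<^sup>+\<omega>. ennreal (exp (r * (X \<omega> / \<tau>)\<^sup>2)) \<partial>M) = ennreal (1 / sqrt w)"
    by (simp only: nn_integral_normal_density[OF s] mult_1_right)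
  then show ?thesis by (simp only: w_def)
qed

section \<open>Trigonometric polynomials\<close>

text \<open>From index 1 on, an orthonormal system for the normalised measure, numbered like the
  coefficients: \<open>2 * k\<close> and \<open>2 * k + 1\<close> both have frequency
  \<open>k\<close>. Index 1 is separate since the odd branch would give
  \<open>sin 0\<close>.\<close>

definition trig_basis :: "nat \<Rightarrow> real \<Rightarrow> real" where
  "trig_basis i x =
    (if i = 1 then 1
     else if even i then sqrt 2 * cos (real (i div 2) * x)
     else sqrt 2 * sin (real (i div 2) * x))"

lemma trig_poly_eq_sum: "trig_poly n a x = (\<Sum>i=1..2 * n + 1. a i * trig_basis i x)"
  unfolding trig_poly_def
  by (induction n) (auto simp: trig_basis_def algebra_simps)

text \<open>Up to the factor \<open>\<sigma>\<^sup>2\<close> this is the covariance of the random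
  polynomial at \<open>x\<close> and \<open>y\<close>. It is the Dirichlet kernel at
  \<open>x - y\<close>, so the variance is the same at every point.\<close>

lemma sum_trig_basis_mult:
  "(\<Sum>i=1..2 * n + 1. trig_basis i x * trig_basis i y) = 1 + 2 * (\<Sum>k=1..n. cos (real k * (x - y)))"
proof (induction n)
  case (Suc n)
  have "(\<Sum>i=1..2 * Suc n + 1. trig_basis i x * trig_basis i y) =
    (\<Sum>i=1..2 * n + 1. trig_basis i x * trig_basis i y)
     + trig_basis (2 * Suc n) x * trig_basis (2 * Suc n) y
     + trig_basis (2 * Suc n + 1) x * trig_basis (2 * Suc n + 1) y"
    by simp
  also have "trig_basis (2 * Suc n) x * trig_basis (2 * Suc n) y =
      2 * (cos (real (Suc n) * x) * cos (real (Suc n) * y))"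
    by (simp add: trig_basis_def)
  also have "trig_basis (2 * Suc n + 1) x * trig_basis (2 * Suc n + 1) y =
      2 * (sin (real (Suc n) * x) * sin (real (Suc n) * y))"
    by (simp add: trig_basis_def)
  also have "cos (real (Suc n) * (x - y)) =
      cos (real (Suc n) * x) * cos (real (Suc n) * y) + sin (real (Suc n) * x) * sin (real (Suc n) * y)"
    by (simp only: right_diff_distrib cos_diff)
  ultimately show ?case using Suc by (simp add: algebra_simps)
qed (simp add: trig_basis_def)

lemma sum_trig_basis_square: "(\<Sum>i=1..2 * n + 1. (trig_basis i x)\<^sup>2) = real (2 * n + 1)"
  using sum_trig_basis_mult[of x x n] by (simp add: power2_eq_square)

section \<open>Dirichlet kernel and equidistant nodes\<close>

text \<open>Multiplied by \<open>sin (t / 2)\<close>, the sum of cosines telescopes. The product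
  form stays valid where the sine vanishes.\<close>

lemma dirichlet_kernel_sin:
  "(1 + 2 * (\<Sum>k=1..n. cos (real k * t))) * sin (t / 2) = sin ((real n + 1 / 2) * t)"
proof (induction n)
  case (Suc n)
  have "2 * (cos (real (Suc n) * t) * sin (t / 2)) =
      sin (real (Suc n) * t + t / 2) - sin (real (Suc n) * t - t / 2)"
    by (simp only: sin_add sin_diff)
  also have "real (Suc n) * t + t / 2 = (real (Suc n) + 1 / 2) * t" by (simp add: algebra_simps)
  also have "real (Suc n) * t - t / 2 = (real n + 1 / 2) * t" by (simp add: algebra_simps)
  finally show ?case using Suc by (simp add: algebra_simps)
qed simp

text \<open>If two nodes differ by \<open>t = 2 * pi * d / N\<close>, then
  \<open>(n + 1 / 2) * t = d * pi\<close> because \<open>N = 2 * n + 1\<close>. The sine of this is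
  zero, while \<open>sin (t / 2)\<close> is not since \<open>0 < \<bar>t / 2\<bar> < pi\<close>; so
  the kernel vanishes at \<open>t\<close>.\<close>

lemma trig_basis_orthogonal_nodes:
  assumes "i < 2 * n + 1" "j < 2 * n + 1" "i \<noteq> j"
  shows "(\<Sum>k=1..2 * n + 1. trig_basis k (2 * pi * real i / real (2 * n + 1))
      * trig_basis k (2 * pi * real j / real (2 * n + 1))) = 0"
proof -
  define N where "N = 2 * n + 1"
  define d where "d = real i - real j"
  define t where "t = 2 * pi * real i / real N - 2 * pi * real j / real N"
  have t: "t = 2 * pi * d / real N" by (simp add: t_def d_def diff_divide_distrib right_diff_distrib)
  have N: "real N > 0" by (simp add: N_def)
  have d: "d \<noteq> 0" "\<bar>d\<bar> < real N" using assms by (auto simp: d_def N_def)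
  have "(real n + 1 / 2) * t = d * pi"
    unfolding t using N by (simp add: N_def field_simps)
  moreover have "d = of_int (int i - int j)" by (simp add: d_def)
  ultimately have "sin ((real n + 1 / 2) * t) = 0" by (metis Ints_of_int sin_times_pi_eq_0)
  moreover have "sin (t / 2) \<noteq> 0"
  proof -
    have "\<bar>t / 2\<bar> = pi * (\<bar>d\<bar> / real N)" unfolding t using N by (simp add: abs_mult)
    moreover have "0 < \<bar>d\<bar> / real N" "\<bar>d\<bar> / real N < 1" using d N by (auto simp: field_simps)
    moreover from this have "pi * (\<bar>d\<bar> / real N) < pi * 1"
      by (intro mult_strict_left_mono) auto
    ultimately have "0 < \<bar>t / 2\<bar>" "\<bar>t / 2\<bar> < pi" by (simp_all only: mult_pos_pos pi_gt_zero mult_1_right)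
    then have "0 < sin \<bar>t / 2\<bar>" by (rule sin_gt_zero)
    then show ?thesis by (auto simp: abs_if split: if_splits)
  qed
  ultimately have "1 + 2 * (\<Sum>k=1..n. cos (real k * t)) = 0"
    using dirichlet_kernel_sin[of t n] by auto
  then show ?thesis
    unfolding sum_trig_basis_mult t_def N_def .
qed

section \<open>Orthogonality on the torus and Parseval's identity\<close>

lemma integral_cos_int:
  "((\<lambda>x. cos (of_int m * x)) has_integral (if m = 0 then 2 * pi else 0)) {0..2 * pi}"
proof (cases "m = 0")
  case True
  then show ?thesis using has_integral_const_real[of "1::real" 0 "2 * pi"] by simp
next
  case False
  have "((\<lambda>x. cos (of_int m * x)) has_integral
      sin (of_int m * (2 * pi)) / of_int m - sin (of_int m * 0) / of_int m) {0..2 * pi}"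
    using False
    by (intro fundamental_theorem_of_calculus)
      (auto intro!: derivative_eq_intros simp flip: has_real_derivative_iff_has_vector_derivative)
  moreover have "sin (of_int m * (2 * pi)) = 0"
    using sin_int_2pin[of m] by (simp add: mult.commute)
  ultimately show ?thesis using False by simp
qed

lemma integral_sin_int: "((\<lambda>x. sin (of_int m * x)) has_integral 0) {0..2 * pi}"
proof (cases "m = 0")
  case False
  have "((\<lambda>x. sin (of_int m * x)) has_integral
      - cos (of_int m * (2 * pi)) / of_int m - - cos (of_int m * 0) / of_int m) {0..2 * pi}"
    using False
    by (intro fundamental_theorem_of_calculus)
      (auto intro!: derivative_eq_intros simp flip: has_real_derivative_iff_has_vector_derivative)
  moreover have "cos (of_int m * (2 * pi)) = 1"
    using cos_int_2pin[of m] by (simp add: mult.commute)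
  ultimately show ?thesis using False by simp
qed simp

text \<open>Product-to-sum formulas reduce every product to cosines or sines of integer frequency.
  Only a cosine of frequency zero has a nonzero integral.\<close>

lemma integral_trig_basis_mult:
  assumes "1 \<le> i" "1 \<le> j"
  shows "((\<lambda>x. trig_basis i x * trig_basis j x) has_integral (if i = j then 2 * pi else 0)) {0..2 * pi}"
proof -
  let ?k = "int (i div 2)" and ?l = "int (j div 2)"
  note C = integral_cos_int[of "?k - ?l"] integral_cos_int[of "?k + ?l"]
  note S = integral_sin_int[of "?k - ?l"] integral_sin_int[of "?k + ?l"]
  have cc: "sqrt 2 * cos (real k * x) * (sqrt 2 * cos (real l * x)) =
      cos (of_int (int k - int l) * x) + cos (of_int (int k + int l) * x)" for k l x
    by (simp add: cos_diff cos_add algebra_simps)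
  have ss: "sqrt 2 * sin (real k * x) * (sqrt 2 * sin (real l * x)) =
      cos (of_int (int k - int l) * x) - cos (of_int (int k + int l) * x)" for k l x
    by (simp add: cos_diff cos_add algebra_simps)
  have sc: "sqrt 2 * sin (real k * x) * (sqrt 2 * cos (real l * x)) =
      sin (of_int (int k - int l) * x) + sin (of_int (int k + int l) * x)" for k l x
    by (simp add: sin_diff sin_add algebra_simps)
  have cs: "sqrt 2 * cos (real k * x) * (sqrt 2 * sin (real l * x)) =
      sin (of_int (int k + int l) * x) - sin (of_int (int k - int l) * x)" for k l x
    by (simp add: sin_diff sin_add algebra_simps)
  have c1: "((\<lambda>x. sqrt 2 * cos (real k * x)) has_integral 0) {0..2 * pi}" if "k > 0" for k
    using has_integral_mult_right[OF integral_cos_int[of "int k"], of "sqrt 2"] that by simp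
  have s1: "((\<lambda>x. sqrt 2 * sin (real k * x)) has_integral 0) {0..2 * pi}" for k
    using has_integral_mult_right[OF integral_sin_int[of "int k"], of "sqrt 2"] by simp
  have b1: "((\<lambda>x. trig_basis k x) has_integral 0) {0..2 * pi}" if "1 < k" for k
    using c1[of "k div 2"] s1[of "k div 2"] that
    by (cases "even k") (auto simp: trig_basis_def[abs_def] div_greater_zero_iff)
  consider "i = 1" "j = 1" | "i = 1" "1 < j" | "1 < i" "j = 1" | "1 < i" "1 < j"
    using assms by linarith
  then show ?thesis
  proof cases
    case 1
    then show ?thesis using integral_cos_int[of 0] by (simp add: trig_basis_def)
  next
    case 2
    then show ?thesis using b1[of j] by (simp add: trig_basis_def[of "Suc 0"])
  next
    case 3
    then show ?thesis using b1[of i] by (simp add: trig_basis_def[of "Suc 0"])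
  next
    case 4
    have pos: "?k > 0" "?l > 0" using 4 by (auto simp: div_greater_zero_iff)
    \<comment> \<open>Parity and frequency together determine the index, so the zero frequency
      arises only from \<open>i = j\<close>.\<close>
    have eq: "i = j" if "even i \<longleftrightarrow> even j" "?k = ?l"
      using that by (metis even_iff_mod_2_eq_zero int_eq_iff_numeral mult_div_mod_eq nat_int not_mod_2_eq_0_eq_1 of_nat_eq_iff)
    show ?thesis
    proof (cases "even i"; cases "even j")
      assume e: "even i" "even j"
      show ?thesis
        using has_integral_add[OF C] e 4 pos eq by (auto simp: trig_basis_def cc split: if_splits)
    next
      assume e: "even i" "odd j"
      show ?thesis
        using has_integral_diff[OF S(2) S(1)] e 4 pos by (auto simp: trig_basis_def cs)
    next
      assume e: "odd i" "even j"
      show ?thesis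
        using has_integral_add[OF S] e 4 pos by (auto simp: trig_basis_def sc)
    next
      assume e: "odd i" "odd j"
      show ?thesis
        using has_integral_diff[OF C] e 4 pos eq by (auto simp: trig_basis_def ss split: if_splits)
    qed
  qed
qed

lemma trig_poly_parseval:
  "((\<lambda>x. (trig_poly n a x)\<^sup>2) has_integral 2 * pi * (\<Sum>i=1..2 * n + 1. (a i)\<^sup>2)) {0..2 * pi}"
proof -
  let ?I = "{1..2 * n + 1}"
  have "((\<lambda>x. \<Sum>i\<in>?I. \<Sum>j\<in>?I. (a i * a j) * (trig_basis i x * trig_basis j x)) has_integral
      (\<Sum>i\<in>?I. \<Sum>j\<in>?I. (a i * a j) * (if i = j then 2 * pi else 0))) {0..2 * pi}"
    by (intro has_integral_sum has_integral_mult_right integral_trig_basis_mult) auto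
  moreover have "(\<lambda>x. \<Sum>i\<in>?I. \<Sum>j\<in>?I. (a i * a j) * (trig_basis i x * trig_basis j x)) = (\<lambda>x. (trig_poly n a x)\<^sup>2)"
    unfolding trig_poly_eq_sum power2_eq_square sum_product by (intro ext sum.cong) auto
  moreover have "(\<Sum>j\<in>?I. (a i * a j) * (if i = j then 2 * pi else 0)) = 2 * pi * (a i)\<^sup>2" if "i \<in> ?I" for i
  proof -
    have "(\<Sum>j\<in>?I. (a i * a j) * (if i = j then 2 * pi else 0)) = (\<Sum>j\<in>?I. if i = j then a i * a j * (2 * pi) else 0)"
      by (intro sum.cong) auto
    also have "\<dots> = a i * a i * (2 * pi)"
      using that by (simp only: sum.delta' finite_atLeastAtMost if_True)
    finally show ?thesis by (simp add: power2_eq_square)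
  qed
  then have "(\<Sum>i\<in>?I. \<Sum>j\<in>?I. (a i * a j) * (if i = j then 2 * pi else 0)) = 2 * pi * (\<Sum>i\<in>?I. (a i)\<^sup>2)"
    unfolding sum_distrib_left by (intro sum.cong refl)
  ultimately show ?thesis by (simp only:)
qed

section \<open>Crude Lipschitz and pointwise bounds\<close>

lemma trig_basis_lipschitz: "\<bar>trig_basis i x - trig_basis i y\<bar> \<le> real i * \<bar>x - y\<bar>"
proof -
  have two: "sqrt 2 * real (i div 2) \<le> real i"
  proof -
    have "sqrt 2 \<le> (2::real)" by (simp add: real_le_lsqrt)
    then have "sqrt 2 * real (i div 2) \<le> 2 * real (i div 2)" by (intro mult_right_mono) auto
    also have "\<dots> \<le> real i" by linarith
    finally show ?thesis .
  qed
  have c: "\<bar>cos u - cos v\<bar> \<le> \<bar>u - v\<bar>" and s: "\<bar>sin u - sin v\<bar> \<le> \<bar>u - v\<bar>" for u v :: real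
  proof -
    have "\<bar>2 * sin ((u + v) / 2) * sin ((v - u) / 2)\<bar> \<le> 2 * 1 * \<bar>(v - u) / 2\<bar>"
      unfolding abs_mult by (intro mult_mono abs_sin_x_le_abs_x abs_sin_le_one) auto
    then show "\<bar>cos u - cos v\<bar> \<le> \<bar>u - v\<bar>" unfolding cos_diff_cos by simp
    have "\<bar>2 * sin ((u - v) / 2) * cos ((u + v) / 2)\<bar> \<le> 2 * \<bar>(u - v) / 2\<bar> * 1"
      unfolding abs_mult by (intro mult_mono abs_sin_x_le_abs_x abs_cos_le_one) auto
    then show "\<bar>sin u - sin v\<bar> \<le> \<bar>u - v\<bar>" unfolding sin_diff_sin by simp
  qed
  have "\<bar>sqrt 2 * cos (real (i div 2) * x) - sqrt 2 * cos (real (i div 2) * y)\<bar> \<le> sqrt 2 * (real (i div 2) * \<bar>x - y\<bar>)"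
    using c[of "real (i div 2) * x" "real (i div 2) * y"]
    by (simp add: abs_mult flip: right_diff_distrib)
  moreover have "\<bar>sqrt 2 * sin (real (i div 2) * x) - sqrt 2 * sin (real (i div 2) * y)\<bar> \<le> sqrt 2 * (real (i div 2) * \<bar>x - y\<bar>)"
    using s[of "real (i div 2) * x" "real (i div 2) * y"]
    by (simp add: abs_mult flip: right_diff_distrib)
  moreover have "sqrt 2 * (real (i div 2) * \<bar>x - y\<bar>) \<le> real i * \<bar>x - y\<bar>"
    using mult_right_mono[OF two, of "\<bar>x - y\<bar>"] by (simp add: mult.assoc)
  ultimately show ?thesis by (auto simp: trig_basis_def)
qed

text \<open>There are \<open>N\<close> terms; in each the coefficient is at most the Euclidean norm
  and the basis function has Lipschitz constant at most \<open>N\<close>.\<close>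

lemma trig_poly_lipschitz:
  "\<bar>trig_poly n a x - trig_poly n a y\<bar> \<le> real (2 * n + 1) ^ 2 * sqrt (\<Sum>i=1..2 * n + 1. (a i)\<^sup>2) * \<bar>x - y\<bar>"
proof -
  let ?I = "{1..2 * n + 1}" and ?s = "sqrt (\<Sum>i=1..2 * n + 1. (a i)\<^sup>2)"
  have "\<bar>trig_poly n a x - trig_poly n a y\<bar> = \<bar>\<Sum>i\<in>?I. a i * (trig_basis i x - trig_basis i y)\<bar>"
    unfolding trig_poly_eq_sum by (simp add: sum_subtractf right_diff_distrib)
  also have "\<dots> \<le> (\<Sum>i\<in>?I. \<bar>a i * (trig_basis i x - trig_basis i y)\<bar>)" by (rule sum_abs)
  also have "\<dots> \<le> (\<Sum>i\<in>?I. ?s * (real (2 * n + 1) * \<bar>x - y\<bar>))"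
  proof (rule sum_mono)
    fix i assume i: "i \<in> ?I"
    have "(a i)\<^sup>2 \<le> (\<Sum>i\<in>?I. (a i)\<^sup>2)" using i by (intro member_le_sum) auto
    then have "\<bar>a i\<bar> \<le> ?s" by (rule real_le_rsqrt[of "\<bar>a i\<bar>", simplified])
    moreover have "\<bar>trig_basis i x - trig_basis i y\<bar> \<le> real (2 * n + 1) * \<bar>x - y\<bar>"
      using i by (intro order_trans[OF trig_basis_lipschitz] mult_right_mono) auto
    ultimately show "\<bar>a i * (trig_basis i x - trig_basis i y)\<bar> \<le> ?s * (real (2 * n + 1) * \<bar>x - y\<bar>)"
      unfolding abs_mult by (intro mult_mono) (auto simp del: sum.cl_ivl_Suc intro: sum_nonneg)
  qed
  also have "\<dots> = real (2 * n + 1) ^ 2 * ?s * \<bar>x - y\<bar>" by (simp add: power2_eq_square)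
  finally show ?thesis .
qed

lemma trig_poly_bound: "\<bar>trig_poly n a x\<bar> \<le> sqrt (real (2 * n + 1) * (\<Sum>i=1..2 * n + 1. (a i)\<^sup>2))"
proof -
  have "(trig_poly n a x)\<^sup>2 \<le> (\<Sum>i=1..2 * n + 1. (a i)\<^sup>2) * (\<Sum>i=1..2 * n + 1. (trig_basis i x)\<^sup>2)"
    unfolding trig_poly_eq_sum by (rule Cauchy_Schwarz_ineq_sum)
  then show ?thesis
    unfolding sum_trig_basis_square by (intro real_le_rsqrt) (simp add: mult.commute)
qed

lemma continuous_on_trig_poly [continuous_intros]: "continuous_on S (trig_poly n a)"
  unfolding trig_poly_def[abs_def] by (intro continuous_intros)

section \<open>Norms on the torus\<close>

text \<open>A probability measure on the whole line, concentrated on one period. Bounds valid only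
  on the interval therefore enter as almost everywhere statements.\<close>

definition torus :: "real measure" where
  "torus = uniform_measure lborel {0..2 * pi}"

lemma sets_torus [simp, measurable_cong]: "sets torus = sets borel"
  and space_torus [simp]: "space torus = UNIV"
  by (simp_all add: torus_def)

interpretation torus: prob_space torus
  unfolding torus_def by (rule prob_space_uniform_measure) auto

lemma prob_torus_UNIV [simp]: "measure torus UNIV = 1"
  using torus.prob_space by simp

lemma AE_torus: "AE x in torus. x \<in> {0..2 * pi}"
  unfolding torus_def by (rule AE_uniform_measureI) auto

lemma integral_torus:
  fixes f :: "real \<Rightarrow> real"
  assumes [measurable]: "f \<in> borel_measurable borel"
  shows "(\<integral>x. f x \<partial>torus) = 1 / (2 * pi) * (LBINT x:{0..2 * pi}. f x)"
proof -
  have eq: "torus = density lborel (\<lambda>x. ennreal (1 / (2 * pi) * indicator {0..2 * pi} x))"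
    unfolding torus_def uniform_measure_def
    by (rule density_cong)
      (auto intro!: AE_I2 simp: indicator_def divide_ennreal simp flip: ennreal_1)
  have "(\<integral>x. f x \<partial>torus) = (\<integral>x. (1 / (2 * pi) * indicator {0..2 * pi} x) *\<^sub>R f x \<partial>lborel)"
    unfolding eq by (rule integral_density) auto
  also have "\<dots> = (\<integral>x. 1 / (2 * pi) * (indicator {0..2 * pi} x *\<^sub>R f x) \<partial>lborel)"
    by (rule Bochner_Integration.integral_cong) auto
  finally show ?thesis unfolding set_lebesgue_integral_def by simp
qed

lemma integrable_torus:
  fixes f :: "real \<Rightarrow> real"
  assumes "continuous_on UNIV f"
  shows "integrable torus f"
proof -
  have "compact (f ` {0..2 * pi})"
    using assms by (intro compact_continuous_image) (auto intro: continuous_on_subset)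
  then obtain b where b: "\<And>x. x \<in> {0..2 * pi} \<Longrightarrow> \<bar>f x\<bar> \<le> b"
    by (meson bounded_real compact_imp_bounded imageI)
  have "f \<in> borel_measurable torus"
    using assms borel_measurable_continuous_onI by (simp cong: measurable_cong_sets)
  moreover have "AE x in torus. norm (f x) \<le> b"
    using AE_torus by eventually_elim (simp add: b)
  ultimately show ?thesis by (intro torus.integrable_const_bound)
qed

lemma measure_torus_Icc:
  assumes "0 \<le> u" "u \<le> v" "v \<le> 2 * pi"
  shows "measure torus {u..v} = (v - u) / (2 * pi)"
proof -
  have "{0..2 * pi} \<inter> {u..v} = {u..v}" using assms by auto
  then show ?thesis unfolding torus_def using assms by (subst measure_uniform_measure) auto
qed

lemma torus_norm_finite:
  assumes "p \<noteq> \<infinity>" "continuous_on UNIV f"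
  shows "torus_norm p f = (\<integral>x. \<bar>f x\<bar> powr enn2real p \<partial>torus) powr (1 / enn2real p)"
proof -
  have "f \<in> borel_measurable borel" using assms(2) by (rule borel_measurable_continuous_onI)
  then show ?thesis
    using assms(1) unfolding torus_norm_def by (subst integral_torus) auto
qed

lemma torus_norm_nonneg:
  assumes "continuous_on UNIV f"
  shows "0 \<le> torus_norm p f"
proof (cases "p = \<infinity>")
  case True
  have "bdd_above ((\<lambda>x. \<bar>f x\<bar>) ` {0..2 * pi})"
    using assms
    by (intro bounded_imp_bdd_above compact_imp_bounded compact_continuous_image continuous_intros)
      (auto intro: continuous_on_subset)
  then have "\<bar>f 0\<bar> \<le> (SUP x\<in>{0..2 * pi}. \<bar>f x\<bar>)" by (intro cSUP_upper) auto
  then show ?thesis using True by (simp add: torus_norm_def)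
qed (simp add: torus_norm_finite assms)

lemma abs_le_torus_norm_infinity:
  assumes "continuous_on UNIV f" "x \<in> {0..2 * pi}"
  shows "\<bar>f x\<bar> \<le> torus_norm \<infinity> f"
proof -
  have "bdd_above ((\<lambda>x. \<bar>f x\<bar>) ` {0..2 * pi})"
    using assms
    by (intro bounded_imp_bdd_above compact_imp_bounded compact_continuous_image continuous_intros)
      (auto intro: continuous_on_subset)
  then show ?thesis using assms(2) by (auto simp: torus_norm_def intro: cSUP_upper)
qed

lemma torus_norm_infinity_attained:
  assumes "continuous_on UNIV f"
  obtains x where "x \<in> {0..2 * pi}" "torus_norm \<infinity> f = \<bar>f x\<bar>"
proof -
  have "\<exists>x\<in>{0..2 * pi}. \<forall>y\<in>{0..2 * pi}. \<bar>f y\<bar> \<le> \<bar>f x\<bar>"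
    using assms by (intro continuous_attains_sup continuous_intros) (auto intro: continuous_on_subset)
  then obtain x where x: "x \<in> {0..2 * pi}" "\<And>y. y \<in> {0..2 * pi} \<Longrightarrow> \<bar>f y\<bar> \<le> \<bar>f x\<bar>"
    by blast
  have "torus_norm \<infinity> f \<le> \<bar>f x\<bar>"
    using x by (auto simp: torus_norm_def intro!: cSUP_least)
  with abs_le_torus_norm_infinity[OF assms x(1)] x(1) that show ?thesis by force
qed

lemma enn2real_ge_1:
  assumes "1 \<le> p" "p \<noteq> \<infinity>"
  shows "1 \<le> enn2real p"
  using enn2real_mono[of 1 p] assms by (simp add: top.not_eq_extremum)

lemma torus_norm_le_infinity:
  assumes f: "continuous_on UNIV f" and "1 \<le> p"
  shows "torus_norm p f \<le> torus_norm \<infinity> f"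
proof (cases "p = \<infinity>")
  case False
  define r where "r = enn2real p"
  have r: "1 \<le> r" using enn2real_ge_1 assms False by (simp add: r_def)
  let ?M = "torus_norm \<infinity> f"
  have "(\<integral>x. \<bar>f x\<bar> powr r \<partial>torus) \<le> (\<integral>x. ?M powr r \<partial>torus)"
  proof (rule integral_mono_AE)
    show "integrable torus (\<lambda>x. \<bar>f x\<bar> powr r)"
      using r f by (intro integrable_torus continuous_intros continuous_on_powr') auto
    show "AE x in torus. \<bar>f x\<bar> powr r \<le> ?M powr r"
      using AE_torus
      by eventually_elim (rule powr_mono2; use r abs_le_torus_norm_infinity[OF f] in simp)
  qed simp
  then have "(\<integral>x. \<bar>f x\<bar> powr r \<partial>torus) powr (1 / r) \<le> (?M powr r) powr (1 / r)"
    using r by (intro powr_mono2) (auto simp: torus.prob_space)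
  also have "\<dots> = ?M" using r torus_norm_nonneg[OF f] by (simp add: powr_powr)
  finally show ?thesis using False f by (simp add: torus_norm_finite r_def)
qed simp

section \<open>Norms of order 1, 2, 4 and \<open>p\<close>\<close>

text \<open>A form of Jensen's inequality with a factor 2 lost, obtained by integrating a pointwise
  bound that truncates at a level \<open>s\<close>.\<close>

lemma mean_abs_le_torus_norm:
  assumes f: "continuous_on UNIV f" and "1 \<le> p" "p \<noteq> \<infinity>"
  shows "(\<integral>x. \<bar>f x\<bar> \<partial>torus) \<le> 2 * torus_norm p f"
proof -
  define r where "r = enn2real p"
  have r: "1 \<le> r" using enn2real_ge_1 assms by (simp add: r_def)
  define A where "A = (\<integral>x. \<bar>f x\<bar> \<partial>torus)"
  define P where "P = (\<integral>x. \<bar>f x\<bar> powr r \<partial>torus)"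
  have int: "integrable torus (\<lambda>x. \<bar>f x\<bar>)" "integrable torus (\<lambda>x. \<bar>f x\<bar> powr r)"
    using r f by (auto intro!: integrable_torus continuous_intros continuous_on_powr')
  show ?thesis
  proof (cases "A > 0")
    case True
    \<comment> \<open>At half the mean, the term \<open>s\<close> in the integrated bound is
      absorbed by \<open>A = 2 * s\<close>, which leaves \<open>s powr r \<le> P\<close>.\<close>
    define s where "s = A / 2"
    have s: "s > 0" using True by (simp add: s_def)
    have pt: "t \<le> s + t powr r / s powr (r - 1)" if "0 \<le> t" for t
    proof (cases "t \<le> s")
      case False
      then have t: "0 < t" "s \<le> t" using s by auto
      have "t * s powr (r - 1) \<le> t * t powr (r - 1)"
        using t s r by (intro mult_left_mono powr_mono2) auto
      also have "\<dots> = t powr r" using t by (simp add: powr_mult_base)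
      finally have "t \<le> t powr r / s powr (r - 1)" using s by (simp add: pos_le_divide_eq)
      then show ?thesis using s by linarith
    qed (use s in \<open>simp add: add_increasing2\<close>)
    have "A \<le> (\<integral>x. s + \<bar>f x\<bar> powr r / s powr (r - 1) \<partial>torus)"
      unfolding A_def using int pt by (intro integral_mono) auto
    also have "\<dots> = s + P / s powr (r - 1)"
      using int by (simp add: P_def)
    finally have "s \<le> P / s powr (r - 1)" unfolding s_def by linarith
    then have "s * s powr (r - 1) \<le> P" using s by (simp add: pos_le_divide_eq)
    then have "s powr r \<le> P" using s by (simp add: powr_mult_base)
    then have "(s powr r) powr (1 / r) \<le> P powr (1 / r)" using r by (intro powr_mono2) auto
    moreover have "(s powr r) powr (1 / r) = s" using s r by (simp add: powr_powr)
    ultimately show ?thesis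
      using assms(3) f by (simp add: torus_norm_finite P_def r_def A_def s_def)
  next
    case False
    then show ?thesis using torus_norm_nonneg[OF f, of p] by (simp add: A_def)
  qed
qed

text \<open>Averages of the pointwise bound \<open>t\<^sup>2 \<le> u \<bar>t\<bar> + t\<^sup>4 / u\<^sup>2\<close>, optimised over \<open>u > 0\<close>; up to the constant
  this is Hoelder's inequality between the norms of order 1, 2 and 4.\<close>

lemma mean_square_cube_le:
  fixes f :: "real \<Rightarrow> real"
  assumes f: "continuous_on UNIV f"
  defines "B \<equiv> \<integral>x. (f x)\<^sup>2 \<partial>torus" and "D \<equiv> \<integral>x. (f x) ^ 4 \<partial>torus"
  shows "B ^ 3 \<le> 8 * D * (\<integral>x. \<bar>f x\<bar> \<partial>torus)\<^sup>2"
proof (cases "B > 0")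
  case True
  define A where "A = (\<integral>x. \<bar>f x\<bar> \<partial>torus)"
  have int: "integrable torus (\<lambda>x. \<bar>f x\<bar>)" "integrable torus (\<lambda>x. (f x)\<^sup>2)" "integrable torus (\<lambda>x. (f x) ^ 4)"
    by (rule integrable_torus, intro continuous_intros f)+
  have key: "B \<le> u * A + D / u\<^sup>2" if u: "u > 0" for u
  proof -
    have pt: "t\<^sup>2 \<le> u * \<bar>t\<bar> + t ^ 4 / u\<^sup>2" for t :: real
    proof (cases "\<bar>t\<bar> \<le> u")
      case True
      then have "\<bar>t\<bar> * \<bar>t\<bar> \<le> u * \<bar>t\<bar>" by (intro mult_right_mono) auto
      then have "t\<^sup>2 \<le> u * \<bar>t\<bar>" by (simp add: power2_eq_square)
      moreover have "0 \<le> t ^ 4 / u\<^sup>2" by simp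
      ultimately show ?thesis by linarith
    next
      case False
      then have "u\<^sup>2 \<le> t\<^sup>2" using u by (metis abs_le_square_iff abs_of_pos linorder_le_cases)
      then have "u\<^sup>2 * t\<^sup>2 \<le> t\<^sup>2 * t\<^sup>2" by (intro mult_right_mono) auto
      then have "t\<^sup>2 \<le> t ^ 4 / u\<^sup>2" using u by (simp add: pos_le_divide_eq mult.commute flip: power_add)
      then show ?thesis using u by (simp add: add_increasing)
    qed
    have "B \<le> (\<integral>x. u * \<bar>f x\<bar> + f x ^ 4 / u\<^sup>2 \<partial>torus)"
      unfolding B_def using int pt by (intro integral_mono) auto
    also have "\<dots> = u * A + D / u\<^sup>2" using int by (simp add: A_def D_def)
    finally show ?thesis .
  qed
  have D0: "D \<ge> 0" unfolding D_def by (intro Bochner_Integration.integral_nonneg) simp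
  have A0: "A \<ge> 0" unfolding A_def by (intro Bochner_Integration.integral_nonneg) simp
  \<comment> \<open>With \<open>D = 0\<close> the bound would read \<open>B \<le> u * A\<close> for
    every \<open>u > 0\<close>, which fails for small \<open>u\<close>.\<close>
  have Dp: "D > 0"
  proof (rule ccontr)
    assume "\<not> D > 0"
    define u where "u = B / (2 * (A + 1))"
    have u: "u > 0" using True A0 by (simp add: u_def)
    have "u * (2 * (A + 1)) = B" using A0 by (simp add: u_def)
    then have "2 * (u * A) + 2 * u = B" by (simp add: algebra_simps)
    moreover have "B \<le> u * A" using key[OF u] D0 \<open>\<not> D > 0\<close> by simp
    moreover have "0 \<le> u * A" using u A0 by simp
    ultimately show False using u by linarith
  qed
  \<comment> \<open>This makes \<open>D / u\<^sup>2\<close> equal to \<open>B / 2\<close>, which is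
    absorbed on the left.\<close>
  define u where "u = sqrt (2 * D / B)"
  have u: "u > 0" "u\<^sup>2 = 2 * D / B" using Dp True by (auto simp: u_def)
  have "B \<le> u * A + B / 2" using key[OF u(1)] unfolding u(2) using Dp True by simp
  then have "B / 2 \<le> u * A" by simp
  then have "(B / 2)\<^sup>2 \<le> (u * A)\<^sup>2" using True by (intro power_mono) auto
  then have "B\<^sup>2 / 4 \<le> 2 * D / B * A\<^sup>2" by (simp add: power_mult_distrib u(2) power_divide)
  then have "B * (B\<^sup>2 / 4) \<le> B * (2 * D / B * A\<^sup>2)" using True by (intro mult_left_mono) auto
  moreover have "B * (2 * D / B * A\<^sup>2) = 2 * D * A\<^sup>2" using True by simp
  moreover have "B * (B\<^sup>2 / 4) = B ^ 3 / 4" by (simp add: power2_eq_square power3_eq_cube)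
  ultimately show ?thesis unfolding A_def by linarith
next
  case False
  then have "B \<le> 0" by simp
  then have "B ^ 3 \<le> 0" by (simp add: power_le_zero_eq)
  moreover have "0 \<le> D" unfolding D_def by (intro Bochner_Integration.integral_nonneg) simp
  ultimately show ?thesis by (intro order_trans[OF \<open>B ^ 3 \<le> 0\<close>] mult_nonneg_nonneg) auto
qed


text \<open>A single quantity with bounded expectation that controls all norms of \<open>f / \<tau>\<close> from above.\<close>

definition exp_mean :: "real \<Rightarrow> (real \<Rightarrow> real) \<Rightarrow> real" where
  "exp_mean \<tau> f = (\<integral>x. exp ((f x / \<tau>)\<^sup>2 / 4) \<partial>torus)"

section \<open>Bounds for norms in terms of \<open>exp_mean\<close>\<close>

lemma integrable_exp_mean:
  fixes f :: "real \<Rightarrow> real"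
  assumes "continuous_on UNIV f"
  shows "integrable torus (\<lambda>x. exp ((f x / \<tau>)\<^sup>2 / r))"
  unfolding divide_inverse by (intro integrable_torus continuous_intros assms)

lemma one_le_exp_mean:
  assumes "continuous_on UNIV f"
  shows "1 \<le> exp_mean \<tau> f"
proof -
  have "(\<integral>x. 1 \<partial>torus) \<le> exp_mean \<tau> f"
    unfolding exp_mean_def by (intro integral_mono integrable_exp_mean assms) auto
  then show ?thesis by simp
qed

text \<open>Raising \<open>y \<le> exp y\<close> at \<open>y = t\<^sup>2 / (4 * r)\<close> to the
  power \<open>r / 2\<close> bounds \<open>\<bar>t\<bar> powr r\<close> by a multiple of
  \<open>exp (t\<^sup>2 / 8)\<close>. The 8, rather than 4, leaves room for Cauchy-Schwarz and so
  yields only the square root of \<open>exp_mean\<close>.\<close>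

lemma mean_powr_le_exp_mean:
  fixes f :: "real \<Rightarrow> real"
  assumes f: "continuous_on UNIV f" and r: "1 \<le> r"
  shows "(\<integral>x. \<bar>f x / \<tau>\<bar> powr r \<partial>torus) \<le> (4 * r) powr (r / 2) * sqrt (exp_mean \<tau> f)"
proof -
  define g where "g x = f x / \<tau>" for x
  have g: "continuous_on UNIV g"
    unfolding g_def divide_inverse by (intro continuous_intros f)
  define K where "K = (4 * r) powr (r / 2)"
  define J where "J = (\<integral>x. exp ((g x)\<^sup>2 / 8) \<partial>torus)"
  have intJ: "integrable torus (\<lambda>x. exp ((g x)\<^sup>2 / 8))" "integrable torus (\<lambda>x. (exp ((g x)\<^sup>2 / 8))\<^sup>2)"
    by (rule integrable_torus, intro continuous_intros g, simp)+
  have pt: "\<bar>t\<bar> powr r \<le> K * exp (t\<^sup>2 / 8)" for t :: real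
  proof -
    have "t\<^sup>2 / (4 * r) \<le> exp (t\<^sup>2 / (4 * r))" by (rule order_trans[OF _ exp_ge_add_one_self]) simp
    then have "t\<^sup>2 \<le> 4 * r * exp (t\<^sup>2 / (4 * r))" using r by (simp add: pos_divide_le_eq mult.commute)
    then have "(t\<^sup>2) powr (r / 2) \<le> (4 * r * exp (t\<^sup>2 / (4 * r))) powr (r / 2)"
      using r by (intro powr_mono2) auto
    also have "\<dots> = K * exp (t\<^sup>2 / 8)"
      using r unfolding powr_mult K_def by (simp add: powr_def[of "exp _"])
    also have "(t\<^sup>2) powr (r / 2) = \<bar>t\<bar> powr r"
    proof -
      have "t\<^sup>2 = \<bar>t\<bar> powr 2" by (cases "t = 0") simp_all
      then show ?thesis by (simp only: powr_powr) simp
    qed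
    finally show ?thesis .
  qed
  have "(\<integral>x. \<bar>g x\<bar> powr r \<partial>torus) \<le> (\<integral>x. K * exp ((g x)\<^sup>2 / 8) \<partial>torus)"
  proof (rule integral_mono)
    show "integrable torus (\<lambda>x. \<bar>g x\<bar> powr r)"
      using r g by (intro integrable_torus continuous_intros continuous_on_powr') auto
  qed (use intJ pt in auto)
  also have "\<dots> = K * J" by (simp add: J_def)
  also have "\<dots> \<le> K * sqrt (exp_mean \<tau> f)"
  proof (intro mult_left_mono real_le_rsqrt)
    \<comment> \<open>Nonnegativity of the variance serves as the Cauchy-Schwarz inequality.\<close>
    have "0 \<le> torus.variance (\<lambda>x. exp ((g x)\<^sup>2 / 8))" by (rule torus.variance_positive)
    then have "J\<^sup>2 \<le> (\<integral>x. (exp ((g x)\<^sup>2 / 8))\<^sup>2 \<partial>torus)"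
      using torus.variance_eq[OF intJ] by (simp add: J_def)
    also have "\<dots> = exp_mean \<tau> f"
      unfolding exp_mean_def g_def by (simp flip: exp_double)
    finally show "J\<^sup>2 \<le> exp_mean \<tau> f" .
  qed (simp add: K_def)
  finally show ?thesis by (simp add: g_def K_def)
qed

lemma torus_norm_le_exp_mean:
  assumes f: "continuous_on UNIV f" and q: "1 \<le> q" "q \<noteq> \<infinity>" and t: "0 < \<tau>"
  shows "torus_norm q f \<le> (4 * enn2real q) powr (enn2real q / 2) * \<tau> * sqrt (exp_mean \<tau> f)"
proof -
  define r where "r = enn2real q"
  have r: "1 \<le> r" using enn2real_ge_1 q by (simp add: r_def)
  define K where "K = (4 * r) powr (r / 2)"
  have K: "1 \<le> K" unfolding K_def using r by (intro ge_one_powr_ge_zero) auto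
  define P where "P = (\<integral>x. \<bar>f x / \<tau>\<bar> powr r \<partial>torus)"
  have I: "1 \<le> sqrt (exp_mean \<tau> f)" using one_le_exp_mean[OF f] by simp
  have KI: "1 \<le> K * sqrt (exp_mean \<tau> f)" using mult_mono[OF K I] K by simp
  have "torus_norm q f = (\<tau> powr r * P) powr (1 / r)"
    using t by (simp add: torus_norm_finite[OF q(2) f] P_def r_def abs_divide powr_divide)
  also have "\<dots> = \<tau> * P powr (1 / r)"
    using t r by (simp add: powr_mult P_def powr_powr)
  also have "P powr (1 / r) \<le> (K * sqrt (exp_mean \<tau> f)) powr (1 / r)"
    unfolding P_def K_def using r mean_powr_le_exp_mean[OF f r] by (intro powr_mono2) auto
  \<comment> \<open>The base is at least 1, so the exponent \<open>1 / r\<close> may be raised to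
    1.\<close>
  also have "\<dots> \<le> (K * sqrt (exp_mean \<tau> f)) powr 1"
    using r KI by (intro powr_mono) auto
  also have "\<dots> = K * sqrt (exp_mean \<tau> f)" using KI by simp
  finally show ?thesis using t by (simp add: K_def r_def mult_ac)
qed

text \<open>In \<open>B ^ 3 \<le> 8 * D * A\<^sup>2\<close>, \<open>B\<close> is large by assumption
  and \<open>D\<close> is controlled by \<open>exp_mean\<close>, so \<open>A\<close>, and with it
  the norm of order \<open>p\<close>, cannot be small. Again only a square root of
  \<open>exp_mean\<close> is lost: two such factors in a ratio make up one \<open>exp_mean\<close>,
  whose expectation is known.\<close>

lemma torus_norm_ge_exp_mean:
  assumes f: "continuous_on UNIV f" and p: "1 \<le> p" "p \<noteq> \<infinity>" and t: "0 < \<tau>"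
    and B: "\<tau>\<^sup>2 / 4 \<le> (\<integral>x. (f x)\<^sup>2 \<partial>torus)"
  shows "\<tau> \<le> 1024 * sqrt (exp_mean \<tau> f) * torus_norm p f"
proof -
  define B where "B = (\<integral>x. (f x)\<^sup>2 \<partial>torus)"
  define D where "D = (\<integral>x. (f x) ^ 4 \<partial>torus)"
  define A where "A = (\<integral>x. \<bar>f x\<bar> \<partial>torus)"
  let ?I = "exp_mean \<tau> f" and ?n = "torus_norm p f"
  have I: "1 \<le> ?I" using one_le_exp_mean[OF f] .
  have "(\<integral>x. \<bar>f x / \<tau>\<bar> powr 4 \<partial>torus) = D / \<tau> ^ 4"
    using t by (simp add: D_def power_divide)
  moreover have "(4 * 4 :: real) powr (4 / 2) = 256" by simp
  ultimately have "D / \<tau> ^ 4 \<le> 256 * sqrt ?I"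
    using mean_powr_le_exp_mean[OF f, of 4 \<tau>] by simp
  moreover have "sqrt ?I \<le> ?I" using I by (simp add: real_le_lsqrt power2_eq_square)
  ultimately have "D / \<tau> ^ 4 \<le> 256 * ?I" by linarith
  then have D: "D \<le> 256 * ?I * \<tau> ^ 4" using t by (simp add: pos_divide_le_eq)
  have D0: "0 \<le> D" unfolding D_def by (intro Bochner_Integration.integral_nonneg) simp
  have "A\<^sup>2 \<le> (2 * ?n)\<^sup>2"
    unfolding A_def using mean_abs_le_torus_norm[OF f p] by (intro power_mono) auto
  have "(\<tau>\<^sup>2 / 4) ^ 3 \<le> B ^ 3" using B by (intro power_mono) (auto simp: B_def)
  also have "\<dots> \<le> 8 * D * A\<^sup>2"
    using mean_square_cube_le[OF f] by (simp add: A_def B_def D_def)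
  also have "\<dots> \<le> 8 * (256 * ?I * \<tau> ^ 4) * (2 * ?n)\<^sup>2"
    using D D0 \<open>A\<^sup>2 \<le> (2 * ?n)\<^sup>2\<close> I by (intro mult_mono) auto
  also have "\<dots> = \<tau> ^ 4 * (524288 * ?I * ?n\<^sup>2) / 64" by (simp add: power_mult_distrib)
  also have "(\<tau>\<^sup>2 / 4) ^ 3 = \<tau> ^ 4 * \<tau>\<^sup>2 / 64" by (simp add: eval_nat_numeral)
  finally have "\<tau> ^ 4 * \<tau>\<^sup>2 \<le> \<tau> ^ 4 * (524288 * ?I * ?n\<^sup>2)" by linarith
  then have "\<tau>\<^sup>2 \<le> 524288 * ?I * ?n\<^sup>2" using t by (subst (asm) mult_le_cancel_left_pos) auto
  \<comment> \<open>Rounding up to \<open>1024\<^sup>2\<close> gives a perfect square.\<close>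
  also have "\<dots> \<le> 1048576 * ?I * ?n\<^sup>2" using I by (intro mult_right_mono) auto
  also have "\<dots> = (1024 * sqrt ?I * ?n)\<^sup>2" using I by (simp add: power_mult_distrib)
  finally show ?thesis
    by (rule power2_le_imp_le) (use I torus_norm_nonneg[OF f] in auto)
qed

text \<open>Only \<open>ln K\<close> enters the resulting bound on the supremum, so a Lipschitz constant that is polynomial
  in the degree suffices and Bernstein's inequality is not needed.\<close>

lemma exp_sup_le_exp_mean:
  assumes f: "continuous_on UNIV f" and t: "0 < \<tau>" and K: "1 \<le> K"
    and lip: "\<And>x y. x \<in> {0..2 * pi} \<Longrightarrow> y \<in> {0..2 * pi} \<Longrightarrow>
        \<bar>f x - f y\<bar> \<le> K * torus_norm \<infinity> f * \<bar>x - y\<bar>"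
  shows "exp ((torus_norm \<infinity> f / \<tau>)\<^sup>2 / 16) \<le> 4 * pi * K * exp_mean \<tau> f"
proof -
  let ?M = "torus_norm \<infinity> f"
  have M: "0 \<le> ?M" by (rule torus_norm_nonneg[OF f])
  obtain x0 where x0: "x0 \<in> {0..2 * pi}" "?M = \<bar>f x0\<bar>"
    using torus_norm_infinity_attained[OF f] .
  \<comment> \<open>Within distance \<open>d\<close> of a maximum point the Lipschitz bound costs at
    most half of the supremum.\<close>
  define d where "d = 1 / (2 * K)"
  have d: "0 < d" "d \<le> 1" "K * d = 1 / 2" using K by (auto simp: d_def field_simps)
  \<comment> \<open>The interval extends from \<open>x0\<close> to the right or to the left,
    whichever keeps it inside the period; \<open>d \<le> 1 < pi\<close> ensures that it
    fits.\<close>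
  define u where "u = (if x0 \<le> pi then x0 else x0 - d)"
  have pi: "3 < pi" using pi_gt3 .
  have x0': "0 \<le> x0" "x0 \<le> 2 * pi" using x0 by auto
  have u: "0 \<le> u" "u + d \<le> 2 * pi" "u \<le> x0" "x0 \<le> u + d"
    using x0' d pi by (auto simp: u_def)
  have low: "?M / 2 \<le> \<bar>f x\<bar>" if x: "x \<in> {u..u + d}" for x
  proof -
    have "\<bar>f x0 - f x\<bar> \<le> K * ?M * \<bar>x0 - x\<bar>" using x u x0 by (intro lip) auto
    also have "\<dots> \<le> K * ?M * d" using u x K M by (intro mult_left_mono) (auto simp: abs_le_iff)
    also have "\<dots> = ?M / 2" using d(3) by (simp add: mult_ac)
    finally show ?thesis using x0(2) by linarith
  qed
  let ?e = "exp ((?M / \<tau>)\<^sup>2 / 16)"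
  have "d / (2 * pi) * ?e = (\<integral>x. indicator {u..u + d} x * ?e \<partial>torus)"
    using u d by (simp add: measure_torus_Icc)
  also have "\<dots> \<le> exp_mean \<tau> f"
    unfolding exp_mean_def
  proof (intro integral_mono integrable_exp_mean f)
    fix x
    show "indicator {u..u + d} x * ?e \<le> exp ((f x / \<tau>)\<^sup>2 / 4)"
    proof (cases "x \<in> {u..u + d}")
      case True
      \<comment> \<open>Halving the supremum quarters its square, which turns the divisor 4 of
        \<open>exp_mean\<close> into 16.\<close>
      have "(?M / 2 / \<tau>)\<^sup>2 \<le> (\<bar>f x\<bar> / \<tau>)\<^sup>2"
        using low[OF True] M t by (intro power_mono divide_right_mono) auto
      then show ?thesis using True by (simp add: power_divide)
    qed simp
  qed (intro integrable_mult_left integrable_real_indicator, simp_all add: torus.emeasure_eq_measure)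
  finally have "2 * pi / d * (d / (2 * pi) * ?e) \<le> 2 * pi / d * exp_mean \<tau> f"
    using d by (intro mult_left_mono) auto
  moreover have "2 * pi / d * (d / (2 * pi) * ?e) = ?e" using d by simp
  moreover have "2 * pi / d = 4 * pi * K" by (simp add: d_def)
  ultimately show ?thesis by (simp only:)
qed

section \<open>Random trigonometric polynomials\<close>

text \<open>Of the Gaussian vector only the independence and the laws of its coordinates are kept.
  Quantifying over instances of the locale yields constants that do not depend on the
  degree.\<close>

locale gaussian_trig_poly = prob_space M for M :: "'w measure" +
  fixes n :: nat and \<sigma> :: real and a :: "nat \<Rightarrow> 'w \<Rightarrow> real"
  assumes n_pos: "1 \<le> n" and sigma_pos: "0 < \<sigma>"
    and indep: "indep_vars (\<lambda>_. borel) a {1..2 * n + 1}"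
    and normal: "\<And>i. i \<in> {1..2 * n + 1} \<Longrightarrow> distributed M lborel (a i) (normal_density 0 \<sigma>)"
begin

abbreviation N :: nat where "N \<equiv> 2 * n + 1"

abbreviation T :: "'w \<Rightarrow> real \<Rightarrow> real" where "T \<omega> \<equiv> trig_poly n (\<lambda>i. a i \<omega>)"

definition \<tau> :: real where "\<tau> = \<sigma> * sqrt (real N)"

lemma tau_pos: "0 < \<tau>"
  using sigma_pos by (simp add: \<tau>_def)

lemma ln_N_ge_1: "1 \<le> ln (real N)"
proof -
  have "exp 1 \<le> real N" using exp_le n_pos by linarith
  then show ?thesis by (subst ln_ge_iff) auto
qed

lemma measurable_coordinate:
  assumes "i \<in> {1..N}"
  shows "a i \<in> borel_measurable M"
  using distributed_measurable[OF normal[OF assms]] by simp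

lemma measurable_T_joint: "(\<lambda>(\<omega>, x). T \<omega> x) \<in> borel_measurable (M \<Otimes>\<^sub>M borel)"
proof -
  have [measurable]: "trig_basis i \<in> borel_measurable borel" for i
    unfolding trig_basis_def[abs_def] by measurable
  have m: "(\<lambda>x. a i (fst x) * trig_basis i (snd x)) \<in> borel_measurable (M \<Otimes>\<^sub>M borel)" if "i \<in> {1..N}" for i
  proof -
    have [measurable]: "a i \<in> borel_measurable M" using that by (rule measurable_coordinate)
    show ?thesis by measurable
  qed
  show ?thesis
    unfolding trig_poly_eq_sum split_beta by (intro borel_measurable_sum m)
qed

lemma measurable_T: "(\<lambda>\<omega>. T \<omega> x) \<in> borel_measurable M"
  using measurable_T_joint by measurable

lemma exp_linear_combination:
  assumes b: "0 < (\<Sum>i=1..N. (b i)\<^sup>2)"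
  shows "integrable M (\<lambda>\<omega>. exp (\<Sum>i=1..N. b i * a i \<omega>))"
    and "expectation (\<lambda>\<omega>. exp (\<Sum>i=1..N. b i * a i \<omega>)) = exp (\<sigma>\<^sup>2 * (\<Sum>i=1..N. (b i)\<^sup>2) / 2)"
proof -
  let ?X = "\<lambda>\<omega>. \<Sum>i=1..N. b i * a i \<omega>"
  have D: "distributed M lborel ?X (normal_density 0 (\<sigma> * sqrt (\<Sum>i=1..N. (b i)\<^sup>2)))"
    using linear_combination_normal[OF _ indep sigma_pos normal b] by simp
  have e: "(\<integral>\<^sup>+\<omega>. ennreal (exp (?X \<omega>)) \<partial>M) = ennreal (exp (\<sigma>\<^sup>2 * (\<Sum>i=1..N. (b i)\<^sup>2) / 2))"
    using normal_exp_moment[OF D, of 1] b sigma_pos by (simp add: power_mult_distrib del: sum.cl_ivl_Suc)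
  have m: "(\<lambda>\<omega>. exp (?X \<omega>)) \<in> borel_measurable M"
    using distributed_measurable[OF D] by simp
  show "integrable M (\<lambda>\<omega>. exp (?X \<omega>))"
    using m e by (intro integrableI_nonneg) auto
  show "expectation (\<lambda>\<omega>. exp (?X \<omega>)) = exp (\<sigma>\<^sup>2 * (\<Sum>i=1..N. (b i)\<^sup>2) / 2)"
    using m e by (subst integral_eq_nn_integral) auto
qed

lemma T_normal: "distributed M lborel (\<lambda>\<omega>. T \<omega> x) (normal_density 0 \<tau>)"
  using linear_combination_normal[OF _ indep sigma_pos normal, of "\<lambda>i. trig_basis i x"]
  by (simp only: sum_trig_basis_square trig_poly_eq_sum \<tau>_def mult.commute[of "trig_basis _ _"]
      finite_atLeastAtMost)

text \<open>By Tonelli the expectation moves inside the mean over the torus. Every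
  \<open>T \<omega> x\<close> has standard deviation \<open>\<tau>\<close>, so the inner integral is
  \<open>1 / sqrt (1 - 1 / 2)\<close> at each point.\<close>

lemma
  shows integrable_exp_mean_T: "integrable M (\<lambda>\<omega>. exp_mean \<tau> (T \<omega>))"
    and expectation_exp_mean_T: "expectation (\<lambda>\<omega>. exp_mean \<tau> (T \<omega>)) = sqrt 2"
proof -
  interpret P: pair_sigma_finite M torus
    by unfold_locales
  have j: "(\<lambda>p. exp ((T (fst p) (snd p) / \<tau>)\<^sup>2 / 4)) \<in> borel_measurable (M \<Otimes>\<^sub>M torus)"
    using measurable_T_joint by (simp add: split_beta cong: measurable_cong_sets sets_pair_measure_cong)
  have m: "(\<lambda>\<omega>. exp_mean \<tau> (T \<omega>)) \<in> borel_measurable M"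
    unfolding exp_mean_def
    using torus.borel_measurable_lebesgue_integral[of "\<lambda>\<omega> x. exp ((T \<omega> x / \<tau>)\<^sup>2 / 4)" M] j
    by (simp add: split_beta)
  have "(\<integral>\<^sup>+\<omega>. ennreal (exp_mean \<tau> (T \<omega>)) \<partial>M) = (\<integral>\<^sup>+\<omega>. \<integral>\<^sup>+x. ennreal (exp ((T \<omega> x / \<tau>)\<^sup>2 / 4)) \<partial>torus \<partial>M)"
    unfolding exp_mean_def
    by (intro nn_integral_cong nn_integral_eq_integral[symmetric] integrable_exp_mean continuous_on_trig_poly) auto
  also have "\<dots> = (\<integral>\<^sup>+x. \<integral>\<^sup>+\<omega>. ennreal (exp ((T \<omega> x / \<tau>)\<^sup>2 / 4)) \<partial>M \<partial>torus)"
    using j by (intro P.Fubini'[symmetric]) (simp add: split_beta)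
  also have "\<dots> = (\<integral>\<^sup>+x. ennreal (sqrt 2) \<partial>torus)"
    using normal_exp_square_moment[OF T_normal tau_pos, of "1 / 4"]
    by (intro nn_integral_cong) (simp add: real_sqrt_divide)
  also have "\<dots> = ennreal (sqrt 2)" by (simp add: torus.emeasure_eq_measure)
  finally have e: "(\<integral>\<^sup>+\<omega>. ennreal (exp_mean \<tau> (T \<omega>)) \<partial>M) = ennreal (sqrt 2)" .
  have pos: "0 \<le> exp_mean \<tau> (T \<omega>)" for \<omega>
    using one_le_exp_mean[OF continuous_on_trig_poly, of \<tau> n "\<lambda>i. a i \<omega>"] by simp
  show "integrable M (\<lambda>\<omega>. exp_mean \<tau> (T \<omega>))"
    using m e pos by (intro integrableI_nonneg) auto
  show "expectation (\<lambda>\<omega>. exp_mean \<tau> (T \<omega>)) = sqrt 2"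
    using m e pos by (subst integral_eq_nn_integral) auto
qed

section \<open>Measurability of the norms and the sum of squares\<close>

lemma measurable_torus_norm_T: "(\<lambda>\<omega>. torus_norm p (T \<omega>)) \<in> borel_measurable M"
proof (cases "p = \<infinity>")
  case True
  \<comment> \<open>Clamping to the period lets the supremum run over all rationals, which are dense
    in the line. They are countable, so the supremum is measurable.\<close>
  define cl where "cl x = max 0 (min (2 * pi) x)" for x :: real
  have cl: "cl x \<in> {0..2 * pi}" and cl_id: "x \<in> {0..2 * pi} \<Longrightarrow> cl x = x" for x
    by (auto simp: cl_def)
  have bdd: "bdd_above ((\<lambda>x. \<bar>T \<omega> (cl x)\<bar>) ` S)" for \<omega> S
    using abs_le_torus_norm_infinity[OF continuous_on_trig_poly cl] by (auto intro!: bdd_aboveI2)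
  have "torus_norm \<infinity> (T \<omega>) = (SUP x\<in>\<rat>. \<bar>T \<omega> (cl x)\<bar>)" for \<omega>
  proof (rule antisym)
    obtain x0 where x0: "x0 \<in> {0..2 * pi}" "torus_norm \<infinity> (T \<omega>) = \<bar>T \<omega> x0\<bar>"
      using torus_norm_infinity_attained[OF continuous_on_trig_poly] .
    have c: "continuous_on (closure \<rat>) (\<lambda>x. \<bar>T \<omega> (cl x)\<bar>)"
      unfolding cl_def
      by (intro continuous_intros continuous_on_compose2[OF continuous_on_trig_poly[of UNIV]]) auto
    have "\<bar>T \<omega> (cl x0)\<bar> \<le> (SUP x\<in>\<rat>. \<bar>T \<omega> (cl x)\<bar>)"
      by (rule continuous_le_on_closure[OF c]) (auto simp: Rats_closure_real bdd intro!: cSUP_upper)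
    then show "torus_norm \<infinity> (T \<omega>) \<le> (SUP x\<in>\<rat>. \<bar>T \<omega> (cl x)\<bar>)"
      using x0 cl_id by simp
    show "(SUP x\<in>\<rat>. \<bar>T \<omega> (cl x)\<bar>) \<le> torus_norm \<infinity> (T \<omega>)"
      by (rule cSUP_least) (use Rats_0 abs_le_torus_norm_infinity[OF continuous_on_trig_poly cl] in auto)
  qed
  moreover have "(\<lambda>\<omega>. SUP x\<in>\<rat>. \<bar>T \<omega> (cl x)\<bar>) \<in> borel_measurable M"
    using measurable_T by (intro borel_measurable_cSUP countable_rat bdd) auto
  ultimately show ?thesis using True by simp
next
  case False
  have "(\<lambda>p'. \<bar>T (fst p') (snd p')\<bar> powr enn2real p) \<in> borel_measurable (M \<Otimes>\<^sub>M torus)"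
    using measurable_T_joint by (simp add: split_beta cong: measurable_cong_sets sets_pair_measure_cong)
  then have "(\<lambda>\<omega>. \<integral>x. \<bar>T \<omega> x\<bar> powr enn2real p \<partial>torus) \<in> borel_measurable M"
    using torus.borel_measurable_lebesgue_integral[of "\<lambda>\<omega> x. \<bar>T \<omega> x\<bar> powr enn2real p" M]
    by (simp add: split_beta)
  then show ?thesis
    unfolding torus_norm_finite[OF False continuous_on_trig_poly] by measurable
qed

lemma mean_square_T: "(\<integral>x. (T \<omega> x)\<^sup>2 \<partial>torus) = (\<Sum>i=1..N. (a i \<omega>)\<^sup>2)"
proof -
  let ?f = "\<lambda>x. (T \<omega> x)\<^sup>2"
  have c: "continuous_on S ?f" for S by (intro continuous_intros)
  have "set_integrable lborel {0..2 * pi} ?f"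
    by (rule borel_integrable_atLeastAtMost') (rule c)
  then have "(LBINT x:{0..2 * pi}. ?f x) = integral {0..2 * pi} ?f"
    by (rule set_borel_integral_eq_integral(2))
  also have "\<dots> = 2 * pi * (\<Sum>i=1..N. (a i \<omega>)\<^sup>2)"
    using trig_poly_parseval by (rule integral_unique)
  finally show ?thesis
    using borel_measurable_continuous_onI[OF c] by (subst integral_torus) (auto simp del: sum.cl_ivl_Suc)
qed

lemma measurable_sum_squares: "(\<lambda>\<omega>. \<Sum>i=1..N. (a i \<omega>)\<^sup>2) \<in> borel_measurable M"
  by (intro borel_measurable_sum borel_measurable_power measurable_coordinate)

text \<open>The first coefficient has a density, hence is almost surely nonzero. This makes all
  norms positive almost surely.\<close>

lemma AE_sum_squares_pos: "AE \<omega> in M. 0 < (\<Sum>i=1..N. (a i \<omega>)\<^sup>2)"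
proof -
  have "AE x in lborel. x \<noteq> (0::real)" by (rule AE_lborel_singleton)
  then have "AE x in density lborel (normal_density 0 \<sigma>). x \<noteq> 0"
    by (subst AE_density) auto
  moreover have "distr M lborel (a 1) = density lborel (normal_density 0 \<sigma>)"
    by (rule distributed_distr_eq_density[OF normal]) simp
  ultimately have "AE x in distr M lborel (a 1). x \<noteq> 0" by (simp only:)
  then have "AE \<omega> in M. a 1 \<omega> \<noteq> 0"
    using measurable_coordinate[of 1] by (subst (asm) AE_distr_iff) auto
  then show ?thesis
  proof eventually_elim
    case (elim \<omega>)
    have "0 < (a 1 \<omega>)\<^sup>2" using elim by simp
    also have "\<dots> \<le> (\<Sum>i=1..N. (a i \<omega>)\<^sup>2)" by (rule member_le_sum) auto
    finally show ?case .
  qed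
qed

text \<open>The exponential rate beats the polynomial bound on the ratio of the norms, which makes negative
  moments of the norms unnecessary.\<close>

lemma prob_small_sum_squares:
  "prob {\<omega> \<in> space M. (\<Sum>i=1..N. (a i \<omega>)\<^sup>2) < \<tau>\<^sup>2 / 4} \<le> (exp (3 / 8) / 2) ^ N"
proof -
  let ?A = "{\<omega> \<in> space M. (\<Sum>i=1..N. (a i \<omega>)\<^sup>2) < \<tau>\<^sup>2 / 4}"
  have A: "?A \<in> sets M" using measurable_sum_squares by measurable
  \<comment> \<open>An exponential Markov bound with exponent \<open>- 3 / 2\<close>: each
    coordinate contributes \<open>1 / sqrt (1 + 3) = 1 / 2\<close>, and the threshold
    \<open>N / 4\<close> contributes \<open>exp (3 / 8)\<close> per coordinate.\<close>
  have e1: "(\<integral>\<^sup>+\<omega>. ennreal (exp (- 3 / 2 * (a i \<omega> / \<sigma>)\<^sup>2)) \<partial>M) = ennreal (1 / 2)" if "i \<in> {1..N}" for i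
    using normal_exp_square_moment[OF normal[OF that] sigma_pos, of "- 3 / 2"] by simp
  have ind: "indep_vars (\<lambda>_. borel) (\<lambda>i \<omega>. ennreal (exp (- 3 / 2 * (a i \<omega> / \<sigma>)\<^sup>2))) {1..N}"
    by (rule indep_vars_compose2[OF indep, of "\<lambda>_ x. ennreal (exp (- 3 / 2 * (x / \<sigma>)\<^sup>2))"]) measurable
  have "emeasure M ?A = (\<integral>\<^sup>+\<omega>. indicator ?A \<omega> \<partial>M)" using A by simp
  also have "\<dots> \<le> (\<integral>\<^sup>+\<omega>. ennreal (exp (3 / 8) ^ N) * (\<Prod>i=1..N. ennreal (exp (- 3 / 2 * (a i \<omega> / \<sigma>)\<^sup>2))) \<partial>M)"
  proof (intro nn_integral_mono)
    fix \<omega>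
    show "indicator ?A \<omega> \<le> ennreal (exp (3 / 8) ^ N) * (\<Prod>i=1..N. ennreal (exp (- 3 / 2 * (a i \<omega> / \<sigma>)\<^sup>2)))"
    proof (cases "\<omega> \<in> ?A")
      case True
      then have "(\<Sum>i=1..N. (a i \<omega>)\<^sup>2) / \<sigma>\<^sup>2 < real N / 4"
        using sigma_pos by (simp add: \<tau>_def power_mult_distrib divide_less_eq mult.commute del: sum.cl_ivl_Suc)
      then have S: "(\<Sum>i=1..N. (a i \<omega> / \<sigma>)\<^sup>2) < real N / 4"
        by (simp only: power_divide sum_divide_distrib)
      have "(\<Prod>i=1..N. exp (- 3 / 2 * (a i \<omega> / \<sigma>)\<^sup>2)) = exp (- 3 / 2 * (\<Sum>i=1..N. (a i \<omega> / \<sigma>)\<^sup>2))"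
        by (simp only: exp_sum[symmetric] finite_atLeastAtMost sum_distrib_left)
      then have "exp (3 / 8) ^ N * (\<Prod>i=1..N. exp (- 3 / 2 * (a i \<omega> / \<sigma>)\<^sup>2)) =
          exp (real N * (3 / 8) + - 3 / 2 * (\<Sum>i=1..N. (a i \<omega> / \<sigma>)\<^sup>2))"
        by (simp only: exp_of_nat_mult[symmetric] exp_add)
      also have "\<dots> \<ge> 1" using S by (simp only: one_le_exp_iff)
      finally have "ennreal 1 \<le> ennreal (exp (3 / 8) ^ N * (\<Prod>i=1..N. exp (- 3 / 2 * (a i \<omega> / \<sigma>)\<^sup>2)))"
        by (rule ennreal_leI)
      then show ?thesis using True
        by (simp only: indicator_simps ennreal_1 ennreal_mult' prod_ennreal exp_ge_zero zero_le_power prod_nonneg)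
    next
      case False
      then have "indicator ?A \<omega> = (0 :: ennreal)" by (rule indicator_simps(2))
      then show ?thesis by (simp only: zero_le)
    qed
  qed
  also have "\<dots> = ennreal (exp (3 / 8) ^ N) * (\<integral>\<^sup>+\<omega>. (\<Prod>i=1..N. ennreal (exp (- 3 / 2 * (a i \<omega> / \<sigma>)\<^sup>2))) \<partial>M)"
    using ind by (intro nn_integral_cmult borel_measurable_prod_ennreal) (auto simp only: indep_vars_def)
  also have "(\<integral>\<^sup>+\<omega>. (\<Prod>i=1..N. ennreal (exp (- 3 / 2 * (a i \<omega> / \<sigma>)\<^sup>2))) \<partial>M) =
      (\<Prod>i=1..N. \<integral>\<^sup>+\<omega>. ennreal (exp (- 3 / 2 * (a i \<omega> / \<sigma>)\<^sup>2)) \<partial>M)"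
    by (rule indep_vars_nn_integral[OF finite_atLeastAtMost ind zero_le])
  also have "\<dots> = (\<Prod>i=1..N. ennreal (1 / 2))"
    by (intro prod.cong refl e1)
  also have "\<dots> = ennreal ((1 / 2) ^ N)"
    by (simp only: prod_constant card_atLeastAtMost ennreal_power) (simp add: ennreal_power)
  also have "ennreal (exp (3 / 8) ^ N) * ennreal ((1 / 2) ^ N) = ennreal ((exp (3 / 8) / 2) ^ N)"
    by (subst ennreal_mult[symmetric], simp, simp, simp only: power_divide power_one times_divide_eq_right mult_1_right)
  finally show ?thesis by (simp add: emeasure_eq_measure)
qed

end

section \<open>Ratios of norms\<close>

text \<open>The order of growth of the norm of order \<open>q\<close> relative to
  \<open>\<tau>\<close>; for finite \<open>p\<close> it coincides with
  \<open>growth_rate p q\<close>.\<close>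

definition sup_factor :: "ennreal \<Rightarrow> nat \<Rightarrow> real" where
  "sup_factor q N = (if q = \<infinity> then sqrt (ln (real N)) else 1)"

text \<open>The finite case is the constant of \<open>torus_norm_le_exp_mean\<close>, the value 10
  that of \<open>sup_le_exp_mean\<close>.\<close>

definition norm_const :: "ennreal \<Rightarrow> real" where
  "norm_const q = (if q = \<infinity> then 10 else (4 * enn2real q) powr (enn2real q / 2))"

lemma norm_const_nonneg: "0 \<le> norm_const q"
  by (simp add: norm_const_def)

context gaussian_trig_poly
begin

section \<open>Pathwise bounds for the norms\<close>

text \<open>By Parseval the sum is a mean square. The bound lets the supremum replace the Euclidean
  norm in the Lipschitz constant.\<close>

lemma sum_squares_le_sup: "(\<Sum>i=1..N. (a i \<omega>)\<^sup>2) \<le> (torus_norm \<infinity> (T \<omega>))\<^sup>2"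
proof -
  have "(\<integral>x. (T \<omega> x)\<^sup>2 \<partial>torus) \<le> (\<integral>x. (torus_norm \<infinity> (T \<omega>))\<^sup>2 \<partial>torus)"
  proof (rule integral_mono_AE)
    show "integrable torus (\<lambda>x. (T \<omega> x)\<^sup>2)" by (intro integrable_torus continuous_intros)
    show "AE x in torus. (T \<omega> x)\<^sup>2 \<le> (torus_norm \<infinity> (T \<omega>))\<^sup>2"
      using AE_torus
    proof eventually_elim
      case (elim x)
      have "\<bar>T \<omega> x\<bar>\<^sup>2 \<le> (torus_norm \<infinity> (T \<omega>))\<^sup>2"
        using abs_le_torus_norm_infinity[OF continuous_on_trig_poly elim] by (rule power_mono) simp
      then show ?case by (simp only: power2_abs)
    qed
  qed simp
  then show ?thesis by (simp add: mean_square_T del: sum.cl_ivl_Suc)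
qed

text \<open>Taking logarithms in \<open>exp_sup_le_exp_mean\<close> with Lipschitz factor
  \<open>(real N)\<^sup>2\<close> leaves a multiple of \<open>ln N\<close> plus
  \<open>ln ?I\<close>; both are at most multiples of \<open>?L * ?I\<close>.\<close>

lemma sup_le_exp_mean: "torus_norm \<infinity> (T \<omega>) \<le> 10 * sqrt (ln (real N)) * \<tau> * sqrt (exp_mean \<tau> (T \<omega>))"
proof -
  let ?M = "torus_norm \<infinity> (T \<omega>)" and ?I = "exp_mean \<tau> (T \<omega>)" and ?L = "ln (real N)"
  have M: "0 \<le> ?M" by (rule torus_norm_nonneg[OF continuous_on_trig_poly])
  have I: "1 \<le> ?I" by (rule one_le_exp_mean[OF continuous_on_trig_poly])
  have N3: "3 \<le> real N" using n_pos by simp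
  have "exp ((?M / \<tau>)\<^sup>2 / 16) \<le> 4 * pi * (real N)\<^sup>2 * ?I"
  proof (rule exp_sup_le_exp_mean[OF continuous_on_trig_poly tau_pos])
    show "1 \<le> (real N)\<^sup>2" using N3 by simp
    fix x y :: real
    have "sqrt (\<Sum>i=1..N. (a i \<omega>)\<^sup>2) \<le> ?M"
      using sum_squares_le_sup M by (rule real_le_lsqrt[rotated])
    then show "\<bar>T \<omega> x - T \<omega> y\<bar> \<le> (real N)\<^sup>2 * ?M * \<bar>x - y\<bar>"
      by (intro order_trans[OF trig_poly_lipschitz] mult_right_mono mult_left_mono) auto
  qed
  also have "\<dots> \<le> real N ^ 3 * (real N)\<^sup>2 * ?I"
  proof -
    have "4 * pi \<le> 3 ^ 3" using pi_less_4 by simp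
    also have "\<dots> \<le> real N ^ 3" using N3 by (intro power_mono) auto
    finally show ?thesis using I by (intro mult_right_mono) auto
  qed
  also have "\<dots> = real N ^ 5 * ?I" by (simp only: power_add[symmetric]) simp
  finally have "(?M / \<tau>)\<^sup>2 / 16 \<le> ln (real N ^ 5 * ?I)"
    using I N3 by (subst ln_ge_iff) auto
  also have "\<dots> = 5 * ?L + ln ?I"
    using I N3 by (subst ln_mult) (auto simp: ln_realpow)
  also have "\<dots> \<le> 5 * (?L * ?I) + ?L * ?I"
  proof (rule add_mono)
    have "?L * 1 \<le> ?L * ?I" using I ln_N_ge_1 by (intro mult_left_mono) auto
    then show "5 * ?L \<le> 5 * (?L * ?I)" by simp
    have "ln ?I \<le> ?I" using I by (intro less_imp_le ln_less_self) simp
    also have "1 * ?I \<le> ?L * ?I" using I ln_N_ge_1 by (intro mult_right_mono) auto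
    then have "?I \<le> ?L * ?I" by simp
    finally show "ln ?I \<le> ?L * ?I" .
  qed
  \<comment> \<open>96 is 16 times the six copies of \<open>?L * ?I\<close>; it is then rounded up
    to a square.\<close>
  finally have "(?M / \<tau>)\<^sup>2 \<le> 96 * (?L * ?I)" by simp
  also have "\<dots> \<le> 100 * (?L * ?I)" using I ln_N_ge_1 by (intro mult_right_mono) auto
  also have "\<dots> = (10 * sqrt ?L * sqrt ?I)\<^sup>2" using I ln_N_ge_1 by (simp add: power_mult_distrib)
  finally have "?M / \<tau> \<le> 10 * sqrt ?L * sqrt ?I"
    by (rule power2_le_imp_le) (use I ln_N_ge_1 in auto)
  then show ?thesis using tau_pos by (simp add: pos_divide_le_eq mult_ac)
qed

lemma torus_norm_T_le:
  assumes "1 \<le> q"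
  shows "torus_norm q (T \<omega>) \<le> norm_const q * sup_factor q N * \<tau> * sqrt (exp_mean \<tau> (T \<omega>))"
proof (cases "q = \<infinity>")
  case True
  show ?thesis
    using sup_le_exp_mean unfolding True norm_const_def sup_factor_def by (simp only: if_True refl)
next
  case False
  show ?thesis
    using torus_norm_le_exp_mean[OF continuous_on_trig_poly assms False tau_pos] False
    unfolding norm_const_def sup_factor_def by simp
qed

text \<open>A deterministic reverse inequality for the exceptional event. Inserting
  \<open>D \<le> ?M\<^sup>2 * B\<close> and \<open>?M\<^sup>2 \<le> N * B\<close> into
  \<open>B ^ 3 \<le> 8 * D * A\<^sup>2\<close> bounds \<open>B\<close>, and hence \<open>?M\<close>,
  by the norm of order \<open>p\<close>.\<close>

lemma sup_le_torus_norm_poly: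
  assumes "1 \<le> p" "p \<noteq> \<infinity>"
  shows "torus_norm \<infinity> (T \<omega>) \<le> 6 * real N * torus_norm p (T \<omega>)"
proof -
  let ?M = "torus_norm \<infinity> (T \<omega>)" and ?n = "torus_norm p (T \<omega>)"
  define B where "B = (\<Sum>i=1..N. (a i \<omega>)\<^sup>2)"
  define A where "A = (\<integral>x. \<bar>T \<omega> x\<bar> \<partial>torus)"
  have n: "0 \<le> ?n" by (rule torus_norm_nonneg[OF continuous_on_trig_poly])
  have M: "0 \<le> ?M" by (rule torus_norm_nonneg[OF continuous_on_trig_poly])
  have B0: "0 \<le> B" unfolding B_def by (intro sum_nonneg) auto
  obtain x0 where "?M = \<bar>T \<omega> x0\<bar>"
    using torus_norm_infinity_attained[OF continuous_on_trig_poly] by blast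
  then have MB: "?M \<le> sqrt (real N * B)" unfolding B_def using trig_poly_bound by metis
  then have "?M\<^sup>2 \<le> (sqrt (real N * B))\<^sup>2" using M by (intro power_mono)
  then have M2: "?M\<^sup>2 \<le> real N * B" using B0 by simp
  show ?thesis
  proof (cases "B = 0")
    case True
    then have "?M \<le> 0" using MB by simp
    also have "0 \<le> 6 * real N * ?n" using n by (intro mult_nonneg_nonneg) auto
    finally show ?thesis .
  next
    case False
    then have B: "0 < B" using B0 by simp
    have "(\<integral>x. T \<omega> x ^ 4 \<partial>torus) \<le> (\<integral>x. ?M\<^sup>2 * (T \<omega> x)\<^sup>2 \<partial>torus)"
    proof (rule integral_mono_AE)
      show "integrable torus (\<lambda>x. T \<omega> x ^ 4)" "integrable torus (\<lambda>x. ?M\<^sup>2 * (T \<omega> x)\<^sup>2)"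
        by (rule integrable_torus, intro continuous_intros)+
      show "AE x in torus. T \<omega> x ^ 4 \<le> ?M\<^sup>2 * (T \<omega> x)\<^sup>2"
        using AE_torus
      proof eventually_elim
        case (elim x)
        have "\<bar>T \<omega> x\<bar>\<^sup>2 \<le> ?M\<^sup>2"
          using abs_le_torus_norm_infinity[OF continuous_on_trig_poly elim] by (rule power_mono) simp
        then have "(T \<omega> x)\<^sup>2 * (T \<omega> x)\<^sup>2 \<le> ?M\<^sup>2 * (T \<omega> x)\<^sup>2" by (intro mult_right_mono) auto
        then show ?case by (simp only: power_add[symmetric]) simp
      qed
    qed
    then have D: "(\<integral>x. T \<omega> x ^ 4 \<partial>torus) \<le> ?M\<^sup>2 * B"
      by (simp add: mean_square_T B_def del: sum.cl_ivl_Suc)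
    have "A\<^sup>2 \<le> (2 * ?n)\<^sup>2"
      unfolding A_def using mean_abs_le_torus_norm[OF continuous_on_trig_poly assms] by (intro power_mono) auto
    have "B ^ 3 \<le> 8 * (\<integral>x. T \<omega> x ^ 4 \<partial>torus) * A\<^sup>2"
      using mean_square_cube_le[OF continuous_on_trig_poly, of n "\<lambda>i. a i \<omega>"]
      unfolding mean_square_T A_def B_def .
    also have "\<dots> \<le> 8 * (?M\<^sup>2 * B) * (2 * ?n)\<^sup>2"
      using D \<open>A\<^sup>2 \<le> (2 * ?n)\<^sup>2\<close> B by (intro mult_mono) auto
    also have "\<dots> = B * (32 * ?M\<^sup>2 * ?n\<^sup>2)" by (simp add: power_mult_distrib)
    finally have "B * B\<^sup>2 \<le> B * (32 * ?M\<^sup>2 * ?n\<^sup>2)" by (simp add: power2_eq_square power3_eq_cube)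
    then have "B\<^sup>2 \<le> 32 * ?M\<^sup>2 * ?n\<^sup>2" using B by (subst (asm) mult_le_cancel_left_pos)
    also have "32 * ?M\<^sup>2 \<le> 36 * (real N * B)"
      using M2 mult_nonneg_nonneg[OF of_nat_0_le_iff B0, of N] by linarith
    then have "32 * ?M\<^sup>2 * ?n\<^sup>2 \<le> 36 * (real N * B) * ?n\<^sup>2" by (intro mult_right_mono) auto
    finally have "B * B \<le> B * (36 * real N * ?n\<^sup>2)" by (simp only: power2_eq_square mult_ac)
    then have "B \<le> 36 * real N * ?n\<^sup>2" using B by (subst (asm) mult_le_cancel_left_pos)
    then have "?M\<^sup>2 \<le> real N * (36 * real N * ?n\<^sup>2)"
      using M2 by (elim order_trans) (intro mult_left_mono, auto)
    also have "\<dots> = (6 * real N * ?n)\<^sup>2" by (simp add: power2_eq_square algebra_simps)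
    finally show ?thesis by (rule power2_le_imp_le) (use n in auto)
  qed
qed

lemma torus_norm_pos:
  assumes "0 < (\<Sum>i=1..N. (a i \<omega>)\<^sup>2)" "1 \<le> p"
  shows "0 < torus_norm p (T \<omega>)"
proof -
  have "(\<Sum>i=1..N. (a i \<omega>)\<^sup>2) \<le> (torus_norm \<infinity> (T \<omega>))\<^sup>2" by (rule sum_squares_le_sup)
  then have "torus_norm \<infinity> (T \<omega>) \<noteq> 0" using assms(1) by (auto simp del: sum.cl_ivl_Suc)
  then have inf: "0 < torus_norm \<infinity> (T \<omega>)"
    using torus_norm_nonneg[OF continuous_on_trig_poly] by (metis order_le_less)
  show ?thesis
  proof (cases "p = \<infinity>")
    case False
    have "0 < 6 * real N * torus_norm p (T \<omega>)"
      using sup_le_torus_norm_poly[OF assms(2) False] inf by (rule less_le_trans[rotated])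
    then show ?thesis by (simp add: zero_less_mult_iff)
  qed (use inf in simp)
qed

text \<open>At the \<open>N\<close> equidistant nodes the values of \<open>T\<close> are uncorrelated, so the second moment method applies
  to the average \<open>Y\<close> of \<open>exp (r T / \<tau>)\<close> over the nodes.\<close>

lemma prob_small_sup:
  "prob {\<omega> \<in> space M. torus_norm \<infinity> (T \<omega>) < \<tau> * sqrt (ln (real N)) / 8} \<le> 4 / sqrt (ln (real N))"
proof -
  let ?A = "{\<omega> \<in> space M. torus_norm \<infinity> (T \<omega>) < \<tau> * sqrt (ln (real N)) / 8}"
  define L where "L = ln (real N)"
  have L: "1 \<le> L" using ln_N_ge_1 by (simp add: L_def)
  have Npos: "0 < real N" by simp
  show ?thesis
  proof (cases "L < 16")
    \<comment> \<open>For small \<open>N\<close> the claimed bound is at least 1.\<close>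
    case True
    then have "sqrt L \<le> 4" by (intro real_le_lsqrt) auto
    then have "1 \<le> 4 / sqrt L" using L by simp
    then show ?thesis unfolding L_def using prob_le_1[of ?A] by (rule order_trans[rotated])
  next
    case False
    \<comment> \<open>With this choice \<open>exp (r\<^sup>2) = sqrt N\<close>, so the variance of
      \<open>Y\<close> is small compared with the square of its mean.\<close>
    define r where "r = sqrt (L / 2)"
    have r: "0 < r" "r\<^sup>2 = L / 2" using L by (auto simp: r_def)
    define node where "node j = 2 * pi * real j / real N" for j
    have node: "node j \<in> {0..2 * pi}" if "j < N" for j
    proof -
      have "2 * pi * real j \<le> 2 * pi * real N" using that by (intro mult_left_mono) auto
      then show ?thesis using Npos by (simp add: node_def pos_divide_le_eq)
    qed
    \<comment> \<open>Coefficient vectors expressing \<open>r / \<tau> * T \<omega> x\<close>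
      through the Gaussian coordinates.\<close>
    define e where "e x i = r / \<tau> * trig_basis i x" for x i
    have sum_e: "(\<Sum>i=1..N. e x i * e y i) = (r / \<tau>)\<^sup>2 * (\<Sum>i=1..N. trig_basis i x * trig_basis i y)" for x y
      unfolding e_def sum_distrib_left by (intro sum.cong refl) (simp only: power2_eq_square mult_ac)
    have rt: "(r / \<tau>)\<^sup>2 * real N * \<sigma>\<^sup>2 = r\<^sup>2"
      using sigma_pos by (simp add: \<tau>_def power_divide power_mult_distrib)
    have e2: "\<sigma>\<^sup>2 * (\<Sum>i=1..N. (e x i)\<^sup>2) = r\<^sup>2" for x
      using sum_e[of x x] sum_trig_basis_square[where n=n and x=x] rt
      by (simp only: power2_eq_square mult_ac)
    have exp_T: "exp (r / \<tau> * T \<omega> x) = exp (\<Sum>i=1..N. e x i * a i \<omega>)" for \<omega> x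
      unfolding trig_poly_eq_sum e_def sum_distrib_left by (intro arg_cong[where f=exp] sum.cong) auto
    have e2_pos: "0 < (\<Sum>i=1..N. (e x i)\<^sup>2)" for x
      using e2[of x] r(1) sigma_pos by (metis zero_less_mult_pos zero_less_power)
    have int1: "integrable M (\<lambda>\<omega>. exp (r / \<tau> * T \<omega> x))"
      and ex1: "expectation (\<lambda>\<omega>. exp (r / \<tau> * T \<omega> x)) = exp (r\<^sup>2 / 2)" for x
      unfolding exp_T using exp_linear_combination[OF e2_pos] by (simp_all only: e2)
    have exp_TT: "exp (r / \<tau> * T \<omega> x) * exp (r / \<tau> * T \<omega> y) = exp (\<Sum>i=1..N. (e x i + e y i) * a i \<omega>)" for \<omega> x y
      unfolding exp_T by (simp only: exp_add[symmetric] sum.distrib[symmetric] distrib_right)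
    have sq2: "\<sigma>\<^sup>2 * (\<Sum>i=1..N. (e x i + e y i)\<^sup>2) = 2 * r\<^sup>2 + 2 * (\<sigma>\<^sup>2 * (\<Sum>i=1..N. e x i * e y i))" for x y
    proof -
      have "(\<Sum>i=1..N. (e x i + e y i)\<^sup>2) = (\<Sum>i=1..N. (e x i)\<^sup>2) + (\<Sum>i=1..N. (e y i)\<^sup>2) + 2 * (\<Sum>i=1..N. e x i * e y i)"
        by (simp only: power2_sum sum.distrib sum_distrib_left mult.assoc)
      then show ?thesis using e2[of x] e2[of y] by (simp only: distrib_left)
    qed
    have cross: "\<sigma>\<^sup>2 * (\<Sum>i=1..N. e (node j) i * e (node k) i) = (if j = k then r\<^sup>2 else 0)"
      if "j < N" "k < N" for j k
    proof (cases "j = k")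
      case True
      then show ?thesis using e2[of "node j"] by (simp only: power2_eq_square refl if_True)
    next
      case False
      then show ?thesis
        unfolding sum_e node_def using trig_basis_orthogonal_nodes[OF that False] by (simp only: mult_zero_right if_False)
    qed
    \<comment> \<open>At distinct nodes the product has expectation \<open>exp (r\<^sup>2)\<close>,
      the product of the two means; so only diagonal terms contribute to the variance.\<close>
    have int2: "integrable M (\<lambda>\<omega>. exp (r / \<tau> * T \<omega> (node j)) * exp (r / \<tau> * T \<omega> (node k)))"
      and ex2: "expectation (\<lambda>\<omega>. exp (r / \<tau> * T \<omega> (node j)) * exp (r / \<tau> * T \<omega> (node k))) =
         (if j = k then exp (2 * r\<^sup>2) else exp (r\<^sup>2))"
      if "j < N" "k < N" for j k
    proof -
      have s: "\<sigma>\<^sup>2 * (\<Sum>i=1..N. (e (node j) i + e (node k) i)\<^sup>2) = (if j = k then 4 * r\<^sup>2 else 2 * r\<^sup>2)"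
        unfolding sq2 cross[OF that] by simp
      then have "0 < \<sigma>\<^sup>2 * (\<Sum>i=1..N. (e (node j) i + e (node k) i)\<^sup>2)" using r by simp
      then have pos: "0 < (\<Sum>i=1..N. (e (node j) i + e (node k) i)\<^sup>2)"
        using sigma_pos by (metis zero_less_mult_pos zero_less_power)
      show "integrable M (\<lambda>\<omega>. exp (r / \<tau> * T \<omega> (node j)) * exp (r / \<tau> * T \<omega> (node k)))"
        unfolding exp_TT by (rule exp_linear_combination(1)[OF pos])
      show "expectation (\<lambda>\<omega>. exp (r / \<tau> * T \<omega> (node j)) * exp (r / \<tau> * T \<omega> (node k))) =
         (if j = k then exp (2 * r\<^sup>2) else exp (r\<^sup>2))"
        unfolding exp_TT exp_linear_combination(2)[OF pos] s by simp
    qed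
    define Y where "Y \<omega> = (\<Sum>j<N. exp (r / \<tau> * T \<omega> (node j))) / real N" for \<omega>
    have intY: "integrable M Y"
      unfolding Y_def[abs_def] by (intro integrable_divide Bochner_Integration.integrable_sum int1)
    have "expectation Y = (\<Sum>j<N. expectation (\<lambda>\<omega>. exp (r / \<tau> * T \<omega> (node j)))) / real N"
      unfolding Y_def[abs_def]
      by (subst integral_divide_zero, subst Bochner_Integration.integral_sum[OF int1]) (rule refl)
    also have "\<dots> = exp (r\<^sup>2 / 2)"
      unfolding ex1 sum_constant card_lessThan using Npos by (simp del: of_nat_add of_nat_mult)
    finally have EY: "expectation Y = exp (r\<^sup>2 / 2)" .
    have Y2: "(Y \<omega>)\<^sup>2 = (\<Sum>j<N. \<Sum>k<N. exp (r / \<tau> * T \<omega> (node j)) * exp (r / \<tau> * T \<omega> (node k))) / (real N)\<^sup>2" for \<omega>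
      unfolding Y_def power_divide by (simp only: power2_eq_square sum_product)
    have intY2: "integrable M (\<lambda>\<omega>. (Y \<omega>)\<^sup>2)"
      unfolding Y2 by (intro integrable_divide Bochner_Integration.integrable_sum int2) auto
    have "expectation (\<lambda>\<omega>. \<Sum>j<N. \<Sum>k<N. exp (r / \<tau> * T \<omega> (node j)) * exp (r / \<tau> * T \<omega> (node k))) =
        (\<Sum>j<N. expectation (\<lambda>\<omega>. \<Sum>k<N. exp (r / \<tau> * T \<omega> (node j)) * exp (r / \<tau> * T \<omega> (node k))))"
      by (intro Bochner_Integration.integral_sum Bochner_Integration.integrable_sum int2) auto
    also have "\<dots> = (\<Sum>j<N. \<Sum>k<N. expectation (\<lambda>\<omega>. exp (r / \<tau> * T \<omega> (node j)) * exp (r / \<tau> * T \<omega> (node k))))"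
      by (intro sum.cong refl Bochner_Integration.integral_sum int2) auto
    also have "\<dots> = (\<Sum>j<N. \<Sum>k<N. if j = k then exp (2 * r\<^sup>2) else exp (r\<^sup>2))"
      by (intro sum.cong refl ex2) auto
    finally have "expectation (\<lambda>\<omega>. (Y \<omega>)\<^sup>2) = (\<Sum>j<N. \<Sum>k<N. if j = k then exp (2 * r\<^sup>2) else exp (r\<^sup>2)) / (real N)\<^sup>2"
      unfolding Y2 integral_divide_zero by (simp only:)
    also have "(\<Sum>j<N. \<Sum>k<N. if j = k then exp (2 * r\<^sup>2) else exp (r\<^sup>2)) =
        (\<Sum>j<N. \<Sum>k<N. (if j = k then exp (2 * r\<^sup>2) - exp (r\<^sup>2) else 0) + exp (r\<^sup>2))"
      by (intro sum.cong) auto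
    also have "\<dots> = (\<Sum>j<N. (exp (2 * r\<^sup>2) - exp (r\<^sup>2)) + real N * exp (r\<^sup>2))"
      by (intro sum.cong refl) (simp only: sum.distrib sum.delta' finite_lessThan if_True sum_constant card_lessThan)
    also have "\<dots> = real N * (exp (2 * r\<^sup>2) - exp (r\<^sup>2)) + (real N)\<^sup>2 * exp (r\<^sup>2)"
      by (simp only: sum_constant card_lessThan distrib_left power2_eq_square mult.assoc)
    also have "\<dots> / (real N)\<^sup>2 = (exp (2 * r\<^sup>2) - exp (r\<^sup>2)) / real N + exp (r\<^sup>2)"
      using Npos by (simp only: add_divide_distrib power2_eq_square) (simp del: of_nat_add of_nat_mult)
    finally have EY2: "expectation (\<lambda>\<omega>. (Y \<omega>)\<^sup>2) = (exp (2 * r\<^sup>2) - exp (r\<^sup>2)) / real N + exp (r\<^sup>2)" .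
    have sq: "(exp (r\<^sup>2 / 2))\<^sup>2 = exp (r\<^sup>2)" by (simp flip: exp_double)
    have var: "variance Y = (exp (2 * r\<^sup>2) - exp (r\<^sup>2)) / real N"
      using variance_eq[OF intY intY2] unfolding EY2 EY sq by simp
    \<comment> \<open>Half the mean of \<open>Y\<close>. A small supremum forces
      \<open>Y \<le> h\<close>, a deviation of at least \<open>h\<close>, to which Chebyshev's
      inequality applies.\<close>
    define h where "h = exp (r\<^sup>2 / 2) / 2"
    have h: "0 < h" "h\<^sup>2 = exp (r\<^sup>2) / 4" by (simp_all add: h_def power_divide sq)
    have "?A \<subseteq> {\<omega> \<in> space M. \<bar>Y \<omega> - expectation Y\<bar> \<ge> h}"
    proof safe
      fix \<omega> assume lt: "torus_norm \<infinity> (T \<omega>) < \<tau> * sqrt (ln (real N)) / 8"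
      have "Y \<omega> \<le> (\<Sum>j<N. exp (r\<^sup>2 / 4)) / real N"
        unfolding Y_def
      proof (intro divide_right_mono sum_mono)
        fix j assume "j \<in> {..<N}"
        then have "\<bar>T \<omega> (node j)\<bar> \<le> torus_norm \<infinity> (T \<omega>)"
          using abs_le_torus_norm_infinity[OF continuous_on_trig_poly node] by blast
        then have "T \<omega> (node j) \<le> \<tau> * sqrt L / 8" using lt by (simp add: L_def)
        then have "r / \<tau> * T \<omega> (node j) \<le> r / \<tau> * (\<tau> * sqrt L / 8)"
          using r tau_pos by (intro mult_left_mono) auto
        also have "\<dots> = r * sqrt L / 8" using tau_pos by simp
        also have "\<dots> \<le> r * (2 * r) / 8"
        proof -
          have "L \<le> (2 * r)\<^sup>2" using L by (simp add: power_mult_distrib r(2))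
          then have "sqrt L \<le> 2 * r" using r(1) by (intro real_le_lsqrt) auto
          then show ?thesis using r(1) by (intro divide_right_mono mult_left_mono) auto
        qed
        also have "\<dots> = r\<^sup>2 / 4" by (simp add: power2_eq_square)
        finally show "exp (r / \<tau> * T \<omega> (node j)) \<le> exp (r\<^sup>2 / 4)" by simp
      qed simp
      also have "\<dots> = exp (r\<^sup>2 / 4)" using Npos by simp
      also have "\<dots> \<le> h"
      proof -
        \<comment> \<open>\<open>L \<ge> 16\<close> makes \<open>r\<^sup>2 / 4 = L / 8\<close> at
          least 1, so \<open>exp (r\<^sup>2 / 4) \<ge> 2\<close>.\<close>
        have "2 \<le> exp (1::real)" by (rule exp_ge_add_one_self[of 1, simplified])
        also have "\<dots> \<le> exp (r\<^sup>2 / 4)" using False by (simp add: r(2))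
        finally have "2 * exp (r\<^sup>2 / 4) \<le> exp (r\<^sup>2 / 4) * exp (r\<^sup>2 / 4)" by simp
        also have "\<dots> = exp (r\<^sup>2 / 2)" by (simp flip: exp_add)
        finally show ?thesis by (simp add: h_def)
      qed
      finally have "Y \<omega> \<le> h" .
      then show "h \<le> \<bar>Y \<omega> - expectation Y\<bar>" unfolding EY h_def by linarith
    qed
    then have "prob ?A \<le> prob {\<omega> \<in> space M. \<bar>Y \<omega> - expectation Y\<bar> \<ge> h}"
      using borel_measurable_integrable[OF intY] by (intro finite_measure_mono) measurable
    also have "\<dots> \<le> variance Y / h\<^sup>2"
      using Chebyshev_inequality[OF borel_measurable_integrable[OF intY] intY2 h(1)] .
    also have "\<dots> = 4 * (exp (r\<^sup>2) - 1) / real N"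
    proof -
      have "exp (2 * r\<^sup>2) = exp (r\<^sup>2) * exp (r\<^sup>2)" by (simp flip: exp_add)
      moreover have "(E * E - E) / m / (E / 4) = 4 * (E - 1) / m" if "0 < E" "0 < m" for E m :: real
        using that by (simp add: field_simps)
      ultimately show ?thesis unfolding var h(2) using Npos by (simp only: exp_gt_zero)
    qed
    also have "\<dots> \<le> 4 * sqrt (real N) / real N"
    proof -
      have "exp (r\<^sup>2) = sqrt (real N)"
        using Npos by (simp add: r(2) L_def ln_sqrt[symmetric] del: of_nat_add of_nat_mult)
      then show ?thesis using Npos by (intro divide_right_mono) auto
    qed
    also have "\<dots> = 4 / sqrt (real N)"
      using Npos real_div_sqrt[of "real N"] by (simp add: field_simps)
    \<comment> \<open>The rate is weakened to the one wanted in
      \<open>ratio_bound_infinity\<close>.\<close>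
    also have "\<dots> \<le> 4 / sqrt L"
    proof -
      have "L \<le> real N" unfolding L_def using Npos ln_less_self by (intro less_imp_le)
      then show ?thesis using L by (intro divide_left_mono) auto
    qed
    finally show ?thesis by (simp only: L_def)
  qed
qed


section \<open>Upper bounds for the expected ratio\<close>

lemma measurable_ratio: "(\<lambda>\<omega>. torus_norm q (T \<omega>) / torus_norm p (T \<omega>)) \<in> borel_measurable M"
  using measurable_torus_norm_T by measurable

text \<open>Off the event \<open>A\<close> the bounds for numerator and denominator combine to a
  multiple of \<open>exp_mean\<close>; on \<open>A\<close> the polynomial bound applies. The
  integrable majorant \<open>U\<close> gives integrability and the estimate at once.\<close>

lemma ratio_bound_finite:
  assumes p: "1 \<le> p" "p \<noteq> \<infinity>" and q: "1 \<le> q"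
  shows "integrable M (\<lambda>\<omega>. torus_norm q (T \<omega>) / torus_norm p (T \<omega>))"
    and "expectation (\<lambda>\<omega>. torus_norm q (T \<omega>) / torus_norm p (T \<omega>)) \<le>
      1024 * norm_const q * sup_factor q N * sqrt 2 + 6 * (real N * (exp (3 / 8) / 2) ^ N)"
proof -
  let ?R = "\<lambda>\<omega>. torus_norm q (T \<omega>) / torus_norm p (T \<omega>)"
  define A where "A = {\<omega> \<in> space M. (\<Sum>i=1..N. (a i \<omega>)\<^sup>2) < \<tau>\<^sup>2 / 4}"
  define c where "c = norm_const q * sup_factor q N"
  have A: "A \<in> sets M" unfolding A_def using measurable_sum_squares by measurable
  have c: "0 \<le> c" using ln_N_ge_1 by (simp add: c_def norm_const_def sup_factor_def)
  define U where "U \<omega> = 1024 * c * exp_mean \<tau> (T \<omega>) + 6 * real N * indicator A \<omega>" for \<omega>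
  have U: "integrable M U"
    unfolding U_def[abs_def] using A integrable_exp_mean_T by (intro Bochner_Integration.integrable_add integrable_mult_right) (auto simp: emeasure_eq_measure)
  have RU: "?R \<omega> \<le> U \<omega>" if w: "\<omega> \<in> space M" for \<omega>
  proof -
    let ?I = "exp_mean \<tau> (T \<omega>)" and ?p = "torus_norm p (T \<omega>)" and ?q = "torus_norm q (T \<omega>)"
    have I: "1 \<le> ?I" by (rule one_le_exp_mean[OF continuous_on_trig_poly])
    have p0: "0 \<le> ?p" by (rule torus_norm_nonneg[OF continuous_on_trig_poly])
    show ?thesis
    proof (cases "\<omega> \<in> A")
      case True
      have "?q \<le> 6 * real N * ?p"
        using torus_norm_le_infinity[OF continuous_on_trig_poly q] sup_le_torus_norm_poly[OF p] by (rule order_trans)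
      then have "?R \<omega> \<le> 6 * real N"
        \<comment> \<open>A zero denominator makes the quotient 0 by convention.\<close>
        using p0 by (cases "?p = 0") (simp_all add: pos_divide_le_eq)
      moreover have "0 \<le> 1024 * c * ?I" using c I by simp
      ultimately show ?thesis using True by (simp add: U_def)
    next
      case False
      then have "\<tau>\<^sup>2 / 4 \<le> (\<integral>x. (T \<omega> x)\<^sup>2 \<partial>torus)" using w unfolding A_def mean_square_T by auto
      then have t: "\<tau> \<le> 1024 * sqrt ?I * ?p"
        by (rule torus_norm_ge_exp_mean[OF continuous_on_trig_poly p tau_pos])
      then have "0 < 1024 * sqrt ?I * ?p" using tau_pos by linarith
      then have pp: "0 < ?p" using I p0 by (auto simp: zero_less_mult_iff)
      have "?q \<le> c * \<tau> * sqrt ?I" using torus_norm_T_le[OF q] by (simp only: c_def)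
      also have "\<dots> \<le> c * (1024 * sqrt ?I * ?p) * sqrt ?I"
        using t c I by (intro mult_right_mono mult_left_mono) auto
      also have "\<dots> = 1024 * c * ?I * ?p" using I by simp
      finally show ?thesis using pp False by (simp add: U_def pos_divide_le_eq)
    qed
  qed
  have R0: "0 \<le> ?R \<omega>" for \<omega>
    by (intro divide_nonneg_nonneg torus_norm_nonneg continuous_on_trig_poly)
  show int: "integrable M ?R"
  proof (rule Bochner_Integration.integrable_bound[OF U measurable_ratio], rule AE_I2)
    show "norm (?R \<omega>) \<le> norm (U \<omega>)" if "\<omega> \<in> space M" for \<omega>
      using RU[OF that] R0[of \<omega>] by (simp only: real_norm_def abs_of_nonneg)
  qed
  have "expectation ?R \<le> expectation U"
    using int U RU by (intro integral_mono)
  also have "\<dots> = 1024 * c * sqrt 2 + 6 * real N * prob A"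
    unfolding U_def[abs_def] using A integrable_exp_mean_T expectation_exp_mean_T
    by (subst Bochner_Integration.integral_add) (auto simp: emeasure_eq_measure simp del: of_nat_add of_nat_mult)
  also have "\<dots> \<le> 1024 * c * sqrt 2 + 6 * real N * (exp (3 / 8) / 2) ^ N"
    using prob_small_sum_squares unfolding A_def by (intro add_left_mono mult_left_mono) auto
  finally show "expectation ?R \<le> 1024 * norm_const q * sup_factor q N * sqrt 2 + 6 * (real N * (exp (3 / 8) / 2) ^ N)"
    by (simp only: c_def mult.assoc)
qed

text \<open>The ratio never exceeds 1, so the unlikely event of a small supremum costs at most its
  probability. Elsewhere the supremum is at least \<open>\<tau> * s / 8\<close>.\<close>

lemma ratio_bound_infinity:
  assumes q: "1 \<le> q"
  shows "integrable M (\<lambda>\<omega>. torus_norm q (T \<omega>) / torus_norm \<infinity> (T \<omega>))"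
    and "expectation (\<lambda>\<omega>. torus_norm q (T \<omega>) / torus_norm \<infinity> (T \<omega>)) \<le> 1"
    and "q \<noteq> \<infinity> \<Longrightarrow> expectation (\<lambda>\<omega>. torus_norm q (T \<omega>) / torus_norm \<infinity> (T \<omega>)) \<le>
      (8 * norm_const q * sqrt 2 + 4) / sqrt (ln (real N))"
proof -
  let ?R = "\<lambda>\<omega>. torus_norm q (T \<omega>) / torus_norm \<infinity> (T \<omega>)"
  have R1: "?R \<omega> \<le> 1" for \<omega>
    using torus_norm_le_infinity[OF continuous_on_trig_poly q] torus_norm_nonneg[OF continuous_on_trig_poly]
    by (intro divide_le_eq_1[THEN iffD2]) (metis order_le_less)
  have R0: "0 \<le> ?R \<omega>" for \<omega>
    by (intro divide_nonneg_nonneg torus_norm_nonneg continuous_on_trig_poly)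
  show int: "integrable M ?R"
    using R0 R1 by (intro integrable_const_bound[of _ 1] measurable_ratio AE_I2) (simp only: real_norm_def abs_of_nonneg)
  have "expectation ?R \<le> expectation (\<lambda>_. 1)" using int R1 by (intro integral_mono) auto
  then show "expectation ?R \<le> 1" by (simp add: prob_space)
  assume fin: "q \<noteq> \<infinity>"
  define s where "s = sqrt (ln (real N))"
  have s: "1 \<le> s" using ln_N_ge_1 by (simp add: s_def)
  define A where "A = {\<omega> \<in> space M. torus_norm \<infinity> (T \<omega>) < \<tau> * sqrt (ln (real N)) / 8}"
  define c where "c = norm_const q"
  have A: "A \<in> sets M" unfolding A_def using measurable_torus_norm_T by measurable
  have c: "0 \<le> c" by (simp add: c_def norm_const_nonneg)
  define U where "U \<omega> = 8 * c / s * exp_mean \<tau> (T \<omega>) + indicator A \<omega>" for \<omega>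
  have U: "integrable M U"
    unfolding U_def[abs_def] using A integrable_exp_mean_T by (intro Bochner_Integration.integrable_add integrable_mult_right) (auto simp: emeasure_eq_measure)
  have RU: "?R \<omega> \<le> U \<omega>" if w: "\<omega> \<in> space M" for \<omega>
  proof -
    let ?I = "exp_mean \<tau> (T \<omega>)" and ?M = "torus_norm \<infinity> (T \<omega>)" and ?q = "torus_norm q (T \<omega>)"
    have I: "1 \<le> ?I" by (rule one_le_exp_mean[OF continuous_on_trig_poly])
    show ?thesis
    proof (cases "\<omega> \<in> A")
      case True
      moreover have "0 \<le> 8 * c / s * ?I" using c I s by simp
      ultimately show ?thesis using R1[of \<omega>] by (simp add: U_def)
    next
      case False
      then have M: "\<tau> * s / 8 \<le> ?M" using w unfolding A_def s_def by auto
      moreover have "0 < \<tau> * s / 8" using tau_pos s by simp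
      ultimately have Mp: "0 < ?M" by linarith
      have "sqrt ?I \<le> ?I" using I by (intro real_le_lsqrt) (auto simp: power2_eq_square)
      have "?q \<le> c * \<tau> * sqrt ?I"
        using torus_norm_T_le[OF q, of \<omega>] fin by (simp only: c_def sup_factor_def if_False mult_1_right)
      also have "\<dots> \<le> c * \<tau> * ?I"
        using \<open>sqrt ?I \<le> ?I\<close> c tau_pos by (intro mult_left_mono) auto
      also have "\<dots> = 8 * c / s * ?I * (\<tau> * s / 8)" using s by simp
      also have "\<dots> \<le> 8 * c / s * ?I * ?M" using M c s I by (intro mult_left_mono) auto
      finally show ?thesis using Mp False by (simp add: U_def pos_divide_le_eq)
    qed
  qed
  have "expectation ?R \<le> expectation U"
    using int U RU by (intro integral_mono)
  also have "\<dots> = 8 * c / s * sqrt 2 + prob A"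
    unfolding U_def[abs_def] using A integrable_exp_mean_T expectation_exp_mean_T
    by (subst Bochner_Integration.integral_add) (auto simp: emeasure_eq_measure)
  also have "\<dots> \<le> 8 * c / s * sqrt 2 + 4 / s"
    using prob_small_sup unfolding A_def s_def by (intro add_left_mono)
  also have "\<dots> = (8 * c * sqrt 2 + 4) / s" by (simp add: add_divide_distrib)
  finally show "expectation ?R \<le> (8 * norm_const q * sqrt 2 + 4) / sqrt (ln (real N))"
    by (simp only: c_def s_def)
qed

end

section \<open>Constants uniform in the degree\<close>

text \<open>Applied with \<open>r = exp (3 / 8) / 2\<close>, this bounds the contribution of the
  exceptional event uniformly in \<open>N\<close>.\<close>

lemma of_nat_times_power_bounded:
  fixes r :: real
  assumes "\<bar>r\<bar> < 1"
  shows "\<exists>b\<ge>0. \<forall>m. real m * r ^ m \<le> b"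
proof -
  have "(\<lambda>m. real m * r ^ m) \<longlonglongrightarrow> 0"
    using powser_times_n_limit_0[of r] assms by simp
  then have "Bseq (\<lambda>m. real m * r ^ m)" by (intro convergent_imp_Bseq convergentI)
  then obtain b where b: "\<forall>m. norm (real m * r ^ m) \<le> b" "0 < b" by (auto simp: Bseq_def)
  then have "real m * r ^ m \<le> b" for m
    using abs_ge_self[of "real m * r ^ m"] by (metis order_trans real_norm_def)
  then show ?thesis using b(2) by (intro exI[of _ b]) auto
qed

lemma exp_three_eighths: "exp (3 / 8 :: real) < 2"
proof -
  have "3 / 8 < ln (2 :: real)" using ln2_ge_two_thirds by simp
  then have "exp (3 / 8 :: real) < exp (ln 2)" by (simp only: exp_less_cancel_iff)
  then show ?thesis by simp
qed

lemma growth_rate_pos: "1 \<le> ln (real N) \<Longrightarrow> 0 < growth_rate p q N"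
  by (auto simp: growth_rate_def)

text \<open>This reciprocity matches the bound for the inverted ratio with the lower bound
  sought.\<close>

lemma growth_rate_swap: "1 \<le> ln (real N) \<Longrightarrow> growth_rate q p N = 1 / growth_rate p q N"
  by (auto simp: growth_rate_def powr_minus_divide top.not_eq_extremum)

lemma ratio_upper_bound:
  fixes p q :: ennreal
  assumes "1 \<le> p" "1 \<le> q"
  shows "\<exists>c>0. \<forall>n \<sigma> (M :: 'w measure) a. gaussian_trig_poly M n \<sigma> a \<longrightarrow>
    integrable M (\<lambda>\<omega>. torus_norm q (trig_poly n (\<lambda>i. a i \<omega>)) / torus_norm p (trig_poly n (\<lambda>i. a i \<omega>))) \<and>
    prob_space.expectation M (\<lambda>\<omega>. torus_norm q (trig_poly n (\<lambda>i. a i \<omega>)) / torus_norm p (trig_poly n (\<lambda>i. a i \<omega>)))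
      \<le> c * growth_rate p q (2 * n + 1)"
proof (cases "p = \<infinity>")
  case True
  define c where "c = 8 * norm_const q * sqrt 2 + 4"
  have c: "1 \<le> c" using norm_const_nonneg[of q] by (simp add: c_def)
  show ?thesis
  proof (intro exI[of _ c] conjI allI impI)
    fix n \<sigma> and M :: "'w measure" and a
    assume "gaussian_trig_poly M n \<sigma> a"
    then interpret gaussian_trig_poly M n \<sigma> a .
    show "integrable M (\<lambda>\<omega>. torus_norm q (T \<omega>) / torus_norm p (T \<omega>))"
      unfolding True by (rule ratio_bound_infinity(1)[OF assms(2)])
    show "expectation (\<lambda>\<omega>. torus_norm q (T \<omega>) / torus_norm p (T \<omega>)) \<le> c * growth_rate p q N"
    proof (cases "q = \<infinity>")
      case q: True
      show ?thesis
        using ratio_bound_infinity(2)[OF assms(2)] c unfolding True q growth_rate_def by simp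
    next
      case False
      have "growth_rate p q N = 1 / sqrt (ln (real N))"
        using False True ln_N_ge_1
        by (simp add: growth_rate_def powr_minus_divide powr_half_sqrt)
      then show ?thesis
        using ratio_bound_infinity(3)[OF assms(2) False] unfolding True c_def by simp
    qed
  qed (use c in simp)
next
  case False
  obtain b where b: "0 \<le> b" "\<And>m. real m * (exp (3 / 8) / 2) ^ m \<le> b"
    using of_nat_times_power_bounded[of "exp (3 / 8) / 2"] exp_three_eighths by auto
  define c where "c = 1024 * norm_const q * sqrt 2 + 6 * b + 1"
  have c: "1 \<le> c" using norm_const_nonneg[of q] b by (simp add: c_def)
  show ?thesis
  proof (intro exI[of _ c] conjI allI impI)
    fix n \<sigma> and M :: "'w measure" and a
    assume "gaussian_trig_poly M n \<sigma> a"
    then interpret gaussian_trig_poly M n \<sigma> a .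
    show "integrable M (\<lambda>\<omega>. torus_norm q (T \<omega>) / torus_norm p (T \<omega>))"
      by (rule ratio_bound_finite(1)[OF assms(1) False assms(2)])
    have g: "growth_rate p q N = sup_factor q N" "1 \<le> sup_factor q N"
      using False ln_N_ge_1
      by (auto simp: growth_rate_def sup_factor_def powr_half_sqrt top.not_eq_extremum)
    have "expectation (\<lambda>\<omega>. torus_norm q (T \<omega>) / torus_norm p (T \<omega>)) \<le>
        1024 * norm_const q * sup_factor q N * sqrt 2 + 6 * (real N * (exp (3 / 8) / 2) ^ N)"
      by (rule ratio_bound_finite(2)[OF assms(1) False assms(2)])
    also have "\<dots> \<le> 1024 * norm_const q * sup_factor q N * sqrt 2 + 6 * b * sup_factor q N + sup_factor q N"
    proof -
      \<comment> \<open>As \<open>sup_factor\<close> is at least 1, the bounded error term is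
        absorbed into the main order.\<close>
      have "b * 1 \<le> b * sup_factor q N" using b(1) g(2) by (rule mult_left_mono[rotated])
      then show ?thesis using b(2)[of N] g(2) by linarith
    qed
    also have "\<dots> = c * growth_rate p q N" unfolding g(1) c_def by (simp add: algebra_simps)
    finally show "expectation (\<lambda>\<omega>. torus_norm q (T \<omega>) / torus_norm p (T \<omega>)) \<le> c * growth_rate p q N" .
  qed (use c in simp)
qed

theorem theorem1p1:
  fixes p q :: ennreal and \<sigma> :: real
  assumes "1 \<le> p" and "1 \<le> q" and "0 < \<sigma>"
  shows "\<exists>c\<^sub>1>0. \<exists>c\<^sub>2>0. \<forall>n\<ge>1. \<forall>(M :: 'w measure) (a :: nat \<Rightarrow> 'w \<Rightarrow> real).
    prob_space M \<longrightarrow>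
    gaussian_vector M (2 * n + 1) (0\<^sub>v (2 * n + 1)) (\<sigma>\<^sup>2 \<cdot>\<^sub>m 1\<^sub>m (2 * n + 1)) a \<longrightarrow>
    (let T = (\<lambda>\<omega>. trig_poly n (\<lambda>i. a i \<omega>));
         E = prob_space.expectation M (\<lambda>\<omega>. torus_norm q (T \<omega>) / torus_norm p (T \<omega>))
     in integrable M (\<lambda>\<omega>. torus_norm q (T \<omega>) / torus_norm p (T \<omega>)) \<and>
        c\<^sub>1 * growth_rate p q (2 * n + 1) \<le> E \<and> E \<le> c\<^sub>2 * growth_rate p q (2 * n + 1))"
proof -
  obtain C where C: "0 < C" and up: "\<And>n \<sigma> (M :: 'w measure) a. gaussian_trig_poly M n \<sigma> a \<Longrightarrow>
    integrable M (\<lambda>\<omega>. torus_norm q (trig_poly n (\<lambda>i. a i \<omega>)) / torus_norm p (trig_poly n (\<lambda>i. a i \<omega>))) \<and>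
    prob_space.expectation M (\<lambda>\<omega>. torus_norm q (trig_poly n (\<lambda>i. a i \<omega>)) / torus_norm p (trig_poly n (\<lambda>i. a i \<omega>)))
      \<le> C * growth_rate p q (2 * n + 1)"
    using ratio_upper_bound[OF assms(1,2)] by blast
  \<comment> \<open>The same upper bound with the exponents exchanged controls the reciprocal
    ratio.\<close>
  obtain D where D: "0 < D" and lo: "\<And>n \<sigma> (M :: 'w measure) a. gaussian_trig_poly M n \<sigma> a \<Longrightarrow>
    integrable M (\<lambda>\<omega>. torus_norm p (trig_poly n (\<lambda>i. a i \<omega>)) / torus_norm q (trig_poly n (\<lambda>i. a i \<omega>))) \<and>
    prob_space.expectation M (\<lambda>\<omega>. torus_norm p (trig_poly n (\<lambda>i. a i \<omega>)) / torus_norm q (trig_poly n (\<lambda>i. a i \<omega>)))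
      \<le> D * growth_rate q p (2 * n + 1)"
    using ratio_upper_bound[OF assms(2,1)] by blast
  show ?thesis
    unfolding Let_def
  proof (rule exI[of _ "1 / D"], intro conjI exI[of _ C] allI impI)
    fix n and M :: "'w measure" and a
    assume n: "1 \<le> n" and M: "prob_space M"
      and g: "gaussian_vector M (2 * n + 1) (0\<^sub>v (2 * n + 1)) (\<sigma>\<^sup>2 \<cdot>\<^sub>m 1\<^sub>m (2 * n + 1)) a"
    have G: "gaussian_trig_poly M n \<sigma> a"
      using n M assms(3) gaussian_vector_coordinate[OF M g assms(3)] gaussian_vector_indep[OF M g assms(3)]
      by (auto simp: gaussian_trig_poly_def gaussian_trig_poly_axioms_def)
    interpret gaussian_trig_poly M n \<sigma> a by (rule G)
    let ?R = "\<lambda>\<omega>. torus_norm q (T \<omega>) / torus_norm p (T \<omega>)"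
    let ?S = "\<lambda>\<omega>. torus_norm p (T \<omega>) / torus_norm q (T \<omega>)"
    show int: "integrable M ?R" and "expectation ?R \<le> C * growth_rate p q (2 * n + 1)"
      using up[OF G] by auto
    \<comment> \<open>The lower bound aimed at. After the swap of the growth rate,
      \<open>1 / k\<close> is the upper bound for the expectation of the reciprocal ratio.\<close>
    define k where "k = growth_rate p q N / D"
    have k: "0 < k" using growth_rate_pos[OF ln_N_ge_1] D by (simp add: k_def)
    have S: "integrable M ?S" "expectation ?S \<le> 1 / k"
      using lo[OF G] growth_rate_swap[OF ln_N_ge_1, of q p] by (auto simp: k_def)
    have "AE \<omega> in M. 2 * k - k\<^sup>2 * ?S \<omega> \<le> ?R \<omega>"
      using AE_sum_squares_pos
    proof eventually_elim
      case (elim \<omega>)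
      define u where "u = torus_norm p (T \<omega>)"
      define v where "v = torus_norm q (T \<omega>)"
      have "0 < u" "0 < v" using torus_norm_pos[OF elim] assms(1,2) by (auto simp: u_def v_def)
      \<comment> \<open>Dividing this square by \<open>u * v\<close> gives the tangent-line bound
        for the ratio \<open>v / u\<close>. The division needs positive norms, hence the almost
        everywhere statement.\<close>
      moreover have "0 \<le> (v - k * u)\<^sup>2" by simp
      ultimately have "2 * k - k\<^sup>2 * (u / v) \<le> v / u"
        by (simp add: field_simps power2_eq_square)
      then show ?case by (simp only: u_def v_def)
    qed
    then have "expectation (\<lambda>\<omega>. 2 * k - k\<^sup>2 * ?S \<omega>) \<le> expectation ?R"
      by (intro integral_mono_AE int Bochner_Integration.integrable_diff integrable_const integrable_mult_right S(1))
    also have "expectation (\<lambda>\<omega>. 2 * k - k\<^sup>2 * ?S \<omega>) = 2 * k - k\<^sup>2 * expectation ?S"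
      unfolding Bochner_Integration.integral_diff[OF integrable_const integrable_mult_right[OF S(1)]]
      by (simp only: integral_mult_right_zero) (simp add: prob_space)
    finally have "2 * k - k\<^sup>2 * expectation ?S \<le> expectation ?R" .
    moreover have "k\<^sup>2 * expectation ?S \<le> k\<^sup>2 * (1 / k)" using S(2) by (intro mult_left_mono) auto
    moreover have "k\<^sup>2 * (1 / k) = k" using k by (simp add: power2_eq_square)
    ultimately have "k \<le> expectation ?R" by linarith
    then show "1 / D * growth_rate p q (2 * n + 1) \<le> expectation ?R" by (simp add: k_def)
  qed (use C D in auto)
qed

end
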